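(* Let $S$ be an extension of $\mathrm{HA}^\omega$ with a base interpretation of $\mathcal L_S^{\mathcal I}$ that uses the bounding interpretation at the ground type $\mathbb N$. Suppose that the $B$-restricted quantifiers, for a formula $B(x^\sigma,\boldsymbol y)$, are semi-uniform and that $C(x,n^{\mathbb N})$ is a formula of the source language with no positive $\mathcal I$-witnesses. Then the principle $$\forall k^{\mathbb N}\,\exists x\lhd_\sigma B(\boldsymbol y)\,\forall n\le k\,C(x,n)\ \to\ \exists x\lhd_\sigma B(\boldsymbol y)\,\forall n^{\mathbb N}\,C(x,n)$$ is $\mathcal I$-interpretable.
   Context: Source. $\mathrm{HA}^\omega$ is Heyting arithmetic in all finite types generated by $\sigma\to\tau$ from ground types including $\mathbb N$ and $\mathbb B$, with combinators, $0$, successor, recursors, Boolean constants and conditionals, logical equalities $\equiv_\sigma$ at all types, and the usual axioms; $S$ is an extension of it (possibly with further types, constants, relation symbols and axioms) in the language $\mathcal L_S$. Formulas use $\bot,\wedge,\to,\forall x^\sigma,\exists x^\sigma$ and restricted quantifiers (below). $n\le k$ abbreviates a quantifier-free equation of type $\mathbb N$. Target. The target theory $T$ has types and terms including those of $\mathcal L_S$, and witnessing types, including $\mathbb N$, closed under $\rho\to\tau$ and $\rho^*$ (non-empty finite subsets), with combinators, recursors, singleton, union, indexed union, membership and the maximum functional $\mathrm m:\mathbb N^*\to\mathbb N$; it proves the usual elementary facts about these, natural numbers and equality (e.g. $T$ may be the set of truths in the full set-theoretic structure). Boldface letters are (possibly empty) tuples; $\forall\boldsymbol b\in\boldsymbol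 B$ is componentwise. $\mathcal L_S^{\mathcal I}$ adds a unary predicate $\mathcal I_\sigma(x^\sigma)$ for each type. A base interpretation assigns to each relation symbol $R$ tuples of witnessing types $\boldsymbol\tau_R^+,\boldsymbol\tau_R^-$ and a relation $\langle R(\boldsymbol x)\rangle^{\boldsymbol c}_{\boldsymbol d}$ of the target language ($\boldsymbol c:\boldsymbol\tau_R^+$, $\boldsymbol d:\boldsymbol\tau_R^-$); $\langle x\equiv_\sigma y\rangle$ is $x=y$ without witnesses. It uses the bounding interpretation at $\mathbb N$: $\langle\mathcal I_{\mathbb N}(x)\rangle^m$ is $x\le m$ ($m:\mathbb N$, no negative witnesses). $\mathcal U$-interpretation: $\langle\bot\rangle:\equiv\bot$; $\langle A\wedge B\rangle^{\boldsymbol a,\boldsymbol c}_{\boldsymbol b,\boldsymbol d}:\equiv\langle A\rangle^{\boldsymbol a}_{\boldsymbol b}\wedge\langle B\rangle^{\boldsymbol c}_{\boldsymbol d}$; $\langle A\to B\rangle^{\boldsymbol f,\boldsymbol g}_{\boldsymbol a,\boldsymbol d}:\equiv\forall\boldsymbol b\in\boldsymbol g\boldsymbol a\boldsymbol d\,\langle A\rangle^{\boldsymbol a}_{\boldsymbol b}\to\langle B\rangle^{\boldsymbol f\boldsymbol a}_{\boldsymbol d}$; $\langle\forall xA\rangle^{\boldsymbol a}_{\boldsymbol b}:\equiv\forall x\langle A\rangle^{\boldsymbol a}_{\boldsymbol b}$; $\langle\exists xA\rangle^{\boldsymbol a}_{\boldsymbol B}:\equiv\exists x\forall\boldsymbol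 b\in\boldsymbol B\langle A\rangle^{\boldsymbol a}_{\boldsymbol b}$. $A(\boldsymbol x)$ is $\mathcal U$-interpretable if there are closed witnessing terms $\boldsymbol t$ with $T\vdash\forall\boldsymbol b\langle A(\boldsymbol x)\rangle^{\boldsymbol t}_{\boldsymbol b}$. Restricted quantifiers. For a formula $B(x^\sigma,\boldsymbol y)$ there are primitive quantifiers $\forall x\lhd_\sigma B(\boldsymbol y)\,A(x)$, $\exists x\lhd_\sigma B(\boldsymbol y)\,A(x)$ with axioms stating their equivalence with $\forall x^\sigma(B(x,\boldsymbol y)\to A(x))$, $\exists x^\sigma(B(x,\boldsymbol y)\wedge A(x))$. The bounded quantifier $\forall n\le k$ is the restricted quantifier for the formula $n\le k$. Relativization $A^{\mathcal I}$ commutes with connectives, $(\forall x^\sigma A)^{\mathcal I}:\equiv\forall x^\sigma(\mathcal I_\sigma(x)\to A^{\mathcal I})$, $(\exists x^\sigma A)^{\mathcal I}:\equiv\exists x^\sigma(\mathcal I_\sigma(x)\wedge A^{\mathcal I})$, $(\forall x\lhd_\sigma B(\boldsymbol y)A)^{\mathcal I}:\equiv\forall x^\sigma(B(x,\boldsymbol y)^{\mathcal I}\to A^{\mathcal I})$, $(\exists x\lhd_\sigma B(\boldsymbol y)A)^{\mathcal I}:\equiv\exists x^\sigma(B(x,\boldsymbol y)^{\mathcal I}\wedge A^{\mathcal I})$. Put $|A|^{\boldsymbol a}_{\boldsymbol b}:\equiv\langle A^{\mathcal I}\rangle^{\boldsymbol a}_{\boldsymbol b}$; $\boldsymbol a$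 are the positive and $\boldsymbol b$ the negative $\mathcal I$-witnesses of $A$; $A$ has no positive $\mathcal I$-witnesses if the tuple $\boldsymbol a$ is empty. A formula $A(\boldsymbol x)$ is $\mathcal I$-interpretable if $\forall\boldsymbol x(\mathcal I(\boldsymbol x)\to A(\boldsymbol x)^{\mathcal I})$ is $\mathcal U$-interpretable. $B(x^\sigma,\boldsymbol y^{\boldsymbol\tau})$ subsumes $\mathcal I_\sigma(x)$ if $\forall\boldsymbol y(\mathcal I_{\boldsymbol\tau}(\boldsymbol y)\to\forall x^\sigma(B(x,\boldsymbol y)^{\mathcal I}\to\mathcal I_\sigma(x)))$ is $\mathcal U$-interpretable. The $B$-restricted quantifiers are semi-uniform if $B$ subsumes $\mathcal I_\sigma(x)$ and $B$ has no positive $\mathcal I$-witnesses. *)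

theory Defs
  imports Main
begin

section \<open>Types, terms, languages\<close>

text \<open>
  \<^item> \<open>'g\<close>: names of further ground types,
  \<^item> \<open>'c\<close>: names of further constants,
  \<^item> \<open>'r\<close>, \<open>'q\<close>: names of the relation symbols of the source and of the target.

  Source and target share one syntax of types and terms; a language selects the types, constants and
  relation symbols that it has. \<open>Fin \<rho>\<close> is the type \<open>\<rho>*\<close> of non-empty finite subsets.
  A further constant carries its type and a relation symbol its argument types.
\<close>

datatype 'g ty = NatT | BoolT | Ground 'g | Fun "'g ty" "'g ty" | Fin "'g ty"

datatype ('g, 'c) const =
    CK "'g ty" "'g ty"
  | CS "'g ty" "'g ty" "'g ty"
  | CZero
  | CSuc
  | CRec "'g ty"
  | CTrue
  | CFalse
  | CCond "'g ty"
  | CSing "'g ty"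
  | CUnion "'g ty"
  | CIUnion "'g ty" "'g ty"
  | CMax
  | COther 'c "'g ty"

fun const_type :: "('g, 'c) const \<Rightarrow> 'g ty" where
  "const_type (CK \<sigma> \<tau>) = Fun \<sigma> (Fun \<tau> \<sigma>)"
| "const_type (CS \<rho> \<sigma> \<tau>) = Fun (Fun \<rho> (Fun \<sigma> \<tau>)) (Fun (Fun \<rho> \<sigma>) (Fun \<rho> \<tau>))"
| "const_type CZero = NatT"
| "const_type CSuc = Fun NatT NatT"
| "const_type (CRec \<tau>) = Fun \<tau> (Fun (Fun NatT (Fun \<tau> \<tau>)) (Fun NatT \<tau>))"
| "const_type CTrue = BoolT"
| "const_type CFalse = BoolT"
| "const_type (CCond \<tau>) = Fun BoolT (Fun \<tau> (Fun \<tau> \<tau>))"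
| "const_type (CSing \<tau>) = Fun \<tau> (Fin \<tau>)"
| "const_type (CUnion \<tau>) = Fun (Fin \<tau>) (Fun (Fin \<tau>) (Fin \<tau>))"
| "const_type (CIUnion \<rho> \<tau>) = Fun (Fin \<rho>) (Fun (Fun \<rho> (Fin \<tau>)) (Fin \<tau>))"
| "const_type CMax = Fun (Fin NatT) NatT"
| "const_type (COther c \<tau>) = \<tau>"

text \<open>
  Variables are de Bruijn indices. A context is a list of types; its entry number \<open>n\<close> is the type of
  \<open>Var n\<close>. A quantifier binds \<open>Var 0\<close> and extends the context on the left.
\<close>

datatype ('g, 'c) tm =
    Var nat
  | Cst "('g, 'c) const"
  | App "('g, 'c) tm" "('g, 'c) tm" (infixl "\<cdot>" 100)

record ('g, 'c, 's) lang =
  types :: "'g ty set"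
  constants :: "('g, 'c) const set"
  rels :: "('s \<times> 'g ty list) set"

definition lang_ok :: "('g, 'c, 's, 'z) lang_scheme \<Rightarrow> bool" where
  "lang_ok L \<longleftrightarrow>
     (\<forall>\<sigma> \<tau>. Fun \<sigma> \<tau> \<in> types L \<longrightarrow> \<sigma> \<in> types L \<and> \<tau> \<in> types L) \<and>
     (\<forall>\<sigma>. Fin \<sigma> \<in> types L \<longrightarrow> \<sigma> \<in> types L) \<and>
     const_type ` constants L \<subseteq> types L \<and>
     (\<forall>(r, \<tau>s) \<in> rels L. set \<tau>s \<subseteq> types L)"

primrec has_type ::
  "('g, 'c, 's, 'z) lang_scheme \<Rightarrow> 'g ty list \<Rightarrow> ('g, 'c) tm \<Rightarrow> 'g ty \<Rightarrow> bool" where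
  "has_type L \<Gamma> (Var n) \<tau> \<longleftrightarrow> n < length \<Gamma> \<and> \<Gamma> ! n = \<tau>"
| "has_type L \<Gamma> (Cst c) \<tau> \<longleftrightarrow> c \<in> constants L \<and> const_type c = \<tau>"
| "has_type L \<Gamma> (t \<cdot> u) \<tau> \<longleftrightarrow> (\<exists>\<sigma>. has_type L \<Gamma> t (Fun \<sigma> \<tau>) \<and> has_type L \<Gamma> u \<sigma>)"

primrec tsub :: "(nat \<Rightarrow> ('g, 'c) tm) \<Rightarrow> ('g, 'c) tm \<Rightarrow> ('g, 'c) tm" where
  "tsub s (Var n) = s n"
| "tsub s (Cst c) = Cst c"
| "tsub s (t \<cdot> u) = tsub s t \<cdot> tsub s u"

definition lift :: "nat \<Rightarrow> ('g, 'c) tm \<Rightarrow> ('g, 'c) tm" where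
  "lift k = tsub (\<lambda>n. Var (n + k))"

text \<open>The substitution \<open>s\<close> under a binder.\<close>

definition up :: "(nat \<Rightarrow> ('g, 'c) tm) \<Rightarrow> nat \<Rightarrow> ('g, 'c) tm" where
  "up s n = (case n of 0 \<Rightarrow> Var 0 | Suc m \<Rightarrow> lift 1 (s m))"

text \<open>Substitution of \<open>ts\<close> for the first \<open>length ts\<close> variables, which leave the context.\<close>

definition inst :: "('g, 'c) tm list \<Rightarrow> nat \<Rightarrow> ('g, 'c) tm" where
  "inst ts n = (if n < length ts then ts ! n else Var (n - length ts))"

text \<open>\<open>at0 t\<close> replaces \<open>Var 0\<close> by \<open>t\<close>, in the same context.\<close>

definition at0 :: "('g, 'c) tm \<Rightarrow> nat \<Rightarrow> ('g, 'c) tm" where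
  "at0 t n = (case n of 0 \<Rightarrow> t | Suc m \<Rightarrow> Var (Suc m))"

text \<open>
  The renaming \<open>skip j\<close> inserts a fresh variable at position \<open>j\<close> of the context.
\<close>

definition skip :: "nat \<Rightarrow> nat \<Rightarrow> ('g, 'c) tm" where
  "skip j n = Var (if n < j then n else Suc n)"

definition apps :: "('g, 'c) tm \<Rightarrow> ('g, 'c) tm list \<Rightarrow> ('g, 'c) tm" where
  "apps t us = foldl App t us"

definition arrows :: "'g ty list \<Rightarrow> 'g ty \<Rightarrow> 'g ty" where
  "arrows \<sigma>s \<tau> = foldr Fun \<sigma>s \<tau>"

abbreviation zero :: "('g, 'c) tm" where "zero \<equiv> Cst CZero"
abbreviation suc :: "('g, 'c) tm \<Rightarrow> ('g, 'c) tm" where "suc t \<equiv> Cst CSuc \<cdot> t"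

text \<open>
  \<open>n \<le> k\<close> is the equation \<open>n - k = 0\<close> for truncated subtraction, defined by recursion from the predecessor.
\<close>

definition pred_tm :: "('g, 'c) tm" where
  "pred_tm = Cst (CRec NatT) \<cdot> zero \<cdot> Cst (CK NatT NatT)"

definition monus :: "('g, 'c) tm \<Rightarrow> ('g, 'c) tm \<Rightarrow> ('g, 'c) tm" where
  "monus t u = Cst (CRec NatT) \<cdot> t \<cdot> (Cst (CK (Fun NatT NatT) NatT) \<cdot> pred_tm) \<cdot> u"


section \<open>The source theory\<close>

text \<open>
  In \<open>SRAll \<sigma> B A\<close> and \<open>SREx \<sigma> B A\<close>, the restricted quantifiers, \<open>Var 0\<close> is bound in
  \<open>B\<close> as well as in \<open>A\<close>; the other variables of \<open>B\<close> are its parameters \<open>y\<close>.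
\<close>

datatype ('g, 'c, 'r) sfm =
    SBot
  | SEq "'g ty" "('g, 'c) tm" "('g, 'c) tm"
  | SRel 'r "'g ty list" "('g, 'c) tm list"
  | SAnd "('g, 'c, 'r) sfm" "('g, 'c, 'r) sfm"
  | SImp "('g, 'c, 'r) sfm" "('g, 'c, 'r) sfm"
  | SAll "'g ty" "('g, 'c, 'r) sfm"
  | SEx "'g ty" "('g, 'c, 'r) sfm"
  | SRAll "'g ty" "('g, 'c, 'r) sfm" "('g, 'c, 'r) sfm"
  | SREx "'g ty" "('g, 'c, 'r) sfm" "('g, 'c, 'r) sfm"

abbreviation sle :: "('g, 'c) tm \<Rightarrow> ('g, 'c) tm \<Rightarrow> ('g, 'c, 'r) sfm" where
  "sle t u \<equiv> SEq NatT (monus t u) zero"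

abbreviation siff :: "('g, 'c, 'r) sfm \<Rightarrow> ('g, 'c, 'r) sfm \<Rightarrow> ('g, 'c, 'r) sfm" where
  "siff A B \<equiv> SAnd (SImp A B) (SImp B A)"

primrec wf_sfm :: "('g, 'c, 'r, 'z) lang_scheme \<Rightarrow> 'g ty list \<Rightarrow> ('g, 'c, 'r) sfm \<Rightarrow> bool" where
  "wf_sfm L \<Gamma> SBot \<longleftrightarrow> True"
| "wf_sfm L \<Gamma> (SEq \<sigma> t u) \<longleftrightarrow> \<sigma> \<in> types L \<and> has_type L \<Gamma> t \<sigma> \<and> has_type L \<Gamma> u \<sigma>"
| "wf_sfm L \<Gamma> (SRel r \<tau>s ts) \<longleftrightarrow> (r, \<tau>s) \<in> rels L \<and> list_all2 (has_type L \<Gamma>) ts \<tau>s"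
| "wf_sfm L \<Gamma> (SAnd A B) \<longleftrightarrow> wf_sfm L \<Gamma> A \<and> wf_sfm L \<Gamma> B"
| "wf_sfm L \<Gamma> (SImp A B) \<longleftrightarrow> wf_sfm L \<Gamma> A \<and> wf_sfm L \<Gamma> B"
| "wf_sfm L \<Gamma> (SAll \<sigma> A) \<longleftrightarrow> \<sigma> \<in> types L \<and> wf_sfm L (\<sigma> # \<Gamma>) A"
| "wf_sfm L \<Gamma> (SEx \<sigma> A) \<longleftrightarrow> \<sigma> \<in> types L \<and> wf_sfm L (\<sigma> # \<Gamma>) A"
| "wf_sfm L \<Gamma> (SRAll \<sigma> B A) \<longleftrightarrow> \<sigma> \<in> types L \<and> wf_sfm L (\<sigma> # \<Gamma>) B \<and> wf_sfm L (\<sigma> # \<Gamma>) A"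
| "wf_sfm L \<Gamma> (SREx \<sigma> B A) \<longleftrightarrow> \<sigma> \<in> types L \<and> wf_sfm L (\<sigma> # \<Gamma>) B \<and> wf_sfm L (\<sigma> # \<Gamma>) A"

primrec ssub :: "(nat \<Rightarrow> ('g, 'c) tm) \<Rightarrow> ('g, 'c, 'r) sfm \<Rightarrow> ('g, 'c, 'r) sfm" where
  "ssub s SBot = SBot"
| "ssub s (SEq \<sigma> t u) = SEq \<sigma> (tsub s t) (tsub s u)"
| "ssub s (SRel r \<tau>s ts) = SRel r \<tau>s (map (tsub s) ts)"
| "ssub s (SAnd A B) = SAnd (ssub s A) (ssub s B)"
| "ssub s (SImp A B) = SImp (ssub s A) (ssub s B)"
| "ssub s (SAll \<sigma> A) = SAll \<sigma> (ssub (up s) A)"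
| "ssub s (SEx \<sigma> A) = SEx \<sigma> (ssub (up s) A)"
| "ssub s (SRAll \<sigma> B A) = SRAll \<sigma> (ssub (up s) B) (ssub (up s) A)"
| "ssub s (SREx \<sigma> B A) = SREx \<sigma> (ssub (up s) B) (ssub (up s) A)"

text \<open>Universal quantification over a whole context, \<open>Var 0\<close> innermost.\<close>

primrec salls :: "'g ty list \<Rightarrow> ('g, 'c, 'r) sfm \<Rightarrow> ('g, 'c, 'r) sfm" where
  "salls [] A = A"
| "salls (\<tau> # \<Gamma>) A = salls \<Gamma> (SAll \<tau> A)"

record ('g, 'c, 'r) source = "('g, 'c, 'r) lang" +
  saxioms :: "('g, 'c, 'r) sfm set"

text \<open>
  The non-logical axioms of Heyting arithmetic in all finite types, together with the axioms of
  the restricted quantifiers, for all formulas of the language of \<open>S\<close>.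
  In \<open>eq_subst\<close>, the formula \<open>A\<close> of context \<open>\<sigma> # \<Gamma>\<close> is used in the context
  \<open>y, x, \<Gamma>\<close>: \<open>skip 0\<close> turns its first variable into \<open>x\<close>, and \<open>skip 1\<close> into \<open>y\<close>.
\<close>

inductive_set ha_axioms :: "('g, 'c, 'r, 'z) lang_scheme \<Rightarrow> ('g, 'c, 'r) sfm set"
  for S :: "('g, 'c, 'r, 'z) lang_scheme" where
  eq_refl: "\<sigma> \<in> types S \<Longrightarrow> SAll \<sigma> (SEq \<sigma> (Var 0) (Var 0)) \<in> ha_axioms S"
| eq_subst: "\<sigma> \<in> types S \<Longrightarrow> set \<Gamma> \<subseteq> types S \<Longrightarrow> wf_sfm S (\<sigma> # \<Gamma>) A \<Longrightarrow>
    salls \<Gamma> (SAll \<sigma> (SAll \<sigma> (SImp (SEq \<sigma> (Var 1) (Var 0))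
      (SImp (ssub (skip 0) A) (ssub (skip 1) A))))) \<in> ha_axioms S"
| K: "\<sigma> \<in> types S \<Longrightarrow> \<tau> \<in> types S \<Longrightarrow>
    SAll \<sigma> (SAll \<tau> (SEq \<sigma> (Cst (CK \<sigma> \<tau>) \<cdot> Var 1 \<cdot> Var 0) (Var 1))) \<in> ha_axioms S"
| S: "\<rho> \<in> types S \<Longrightarrow> \<sigma> \<in> types S \<Longrightarrow> \<tau> \<in> types S \<Longrightarrow>
    SAll (Fun \<rho> (Fun \<sigma> \<tau>)) (SAll (Fun \<rho> \<sigma>) (SAll \<rho>
      (SEq \<tau> (Cst (CS \<rho> \<sigma> \<tau>) \<cdot> Var 2 \<cdot> Var 1 \<cdot> Var 0) (Var 2 \<cdot> Var 0 \<cdot> (Var 1 \<cdot> Var 0)))))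
    \<in> ha_axioms S"
| rec_zero: "\<tau> \<in> types S \<Longrightarrow>
    SAll \<tau> (SAll (Fun NatT (Fun \<tau> \<tau>))
      (SEq \<tau> (Cst (CRec \<tau>) \<cdot> Var 1 \<cdot> Var 0 \<cdot> zero) (Var 1))) \<in> ha_axioms S"
| rec_suc: "\<tau> \<in> types S \<Longrightarrow>
    SAll \<tau> (SAll (Fun NatT (Fun \<tau> \<tau>)) (SAll NatT
      (SEq \<tau> (Cst (CRec \<tau>) \<cdot> Var 2 \<cdot> Var 1 \<cdot> suc (Var 0))
             (Var 1 \<cdot> Var 0 \<cdot> (Cst (CRec \<tau>) \<cdot> Var 2 \<cdot> Var 1 \<cdot> Var 0))))) \<in> ha_axioms S"
| cond_true: "\<tau> \<in> types S \<Longrightarrow>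
    SAll \<tau> (SAll \<tau> (SEq \<tau> (Cst (CCond \<tau>) \<cdot> Cst CTrue \<cdot> Var 1 \<cdot> Var 0) (Var 1))) \<in> ha_axioms S"
| cond_false: "\<tau> \<in> types S \<Longrightarrow>
    SAll \<tau> (SAll \<tau> (SEq \<tau> (Cst (CCond \<tau>) \<cdot> Cst CFalse \<cdot> Var 1 \<cdot> Var 0) (Var 0))) \<in> ha_axioms S"
| suc_inj: "SAll NatT (SAll NatT (SImp (SEq NatT (suc (Var 1)) (suc (Var 0)))
    (SEq NatT (Var 1) (Var 0)))) \<in> ha_axioms S"
| suc_not_zero: "SAll NatT (SImp (SEq NatT (suc (Var 0)) zero) SBot) \<in> ha_axioms S"
| true_not_false: "SImp (SEq BoolT (Cst CTrue) (Cst CFalse)) SBot \<in> ha_axioms S"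
| induction: "set \<Gamma> \<subseteq> types S \<Longrightarrow> wf_sfm S (NatT # \<Gamma>) A \<Longrightarrow>
    salls \<Gamma> (SImp (ssub (inst [zero]) A)
      (SImp (SAll NatT (SImp A (ssub (at0 (suc (Var 0))) A))) (SAll NatT A))) \<in> ha_axioms S"
| bool_cases: "set \<Gamma> \<subseteq> types S \<Longrightarrow> wf_sfm S (BoolT # \<Gamma>) A \<Longrightarrow>
    salls \<Gamma> (SImp (ssub (inst [Cst CTrue]) A)
      (SImp (ssub (inst [Cst CFalse]) A) (SAll BoolT A))) \<in> ha_axioms S"
| restricted_all: "set \<Gamma> \<subseteq> types S \<Longrightarrow> \<sigma> \<in> types S \<Longrightarrow>
    wf_sfm S (\<sigma> # \<Gamma>) B \<Longrightarrow> wf_sfm S (\<sigma> # \<Gamma>) A \<Longrightarrow>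
    salls \<Gamma> (siff (SRAll \<sigma> B A) (SAll \<sigma> (SImp B A))) \<in> ha_axioms S"
| restricted_ex: "set \<Gamma> \<subseteq> types S \<Longrightarrow> \<sigma> \<in> types S \<Longrightarrow>
    wf_sfm S (\<sigma> # \<Gamma>) B \<Longrightarrow> wf_sfm S (\<sigma> # \<Gamma>) A \<Longrightarrow>
    salls \<Gamma> (siff (SREx \<sigma> B A) (SEx \<sigma> (SAnd B A))) \<in> ha_axioms S"

definition extends_HA :: "('g, 'c, 'r) source \<Rightarrow> bool" where
  "extends_HA S \<longleftrightarrow>
     lang_ok S \<and>
     NatT \<in> types S \<and> BoolT \<in> types S \<and>
     (\<forall>\<sigma> \<in> types S. \<forall>\<tau> \<in> types S. Fun \<sigma> \<tau> \<in> types S) \<and>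
     {CZero, CSuc, CTrue, CFalse} \<subseteq> constants S \<and>
     (\<forall>\<sigma> \<in> types S. CRec \<sigma> \<in> constants S \<and> CCond \<sigma> \<in> constants S) \<and>
     (\<forall>\<sigma> \<in> types S. \<forall>\<tau> \<in> types S. CK \<sigma> \<tau> \<in> constants S) \<and>
     (\<forall>\<rho> \<in> types S. \<forall>\<sigma> \<in> types S. \<forall>\<tau> \<in> types S. CS \<rho> \<sigma> \<tau> \<in> constants S) \<and>
     (\<forall>A \<in> saxioms S. wf_sfm S [] A) \<and>
     ha_axioms S \<subseteq> saxioms S"


section \<open>The target theory\<close>

datatype ('g, 'c, 'q) tfm =
    TBot
  | TEq "'g ty" "('g, 'c) tm" "('g, 'c) tm"
  | TMem "'g ty" "('g, 'c) tm" "('g, 'c) tm"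
  | TRel 'q "'g ty list" "('g, 'c) tm list"
  | TAnd "('g, 'c, 'q) tfm" "('g, 'c, 'q) tfm"
  | TOr "('g, 'c, 'q) tfm" "('g, 'c, 'q) tfm"
  | TImp "('g, 'c, 'q) tfm" "('g, 'c, 'q) tfm"
  | TAll "'g ty" "('g, 'c, 'q) tfm"
  | TEx "'g ty" "('g, 'c, 'q) tfm"

abbreviation tle :: "('g, 'c) tm \<Rightarrow> ('g, 'c) tm \<Rightarrow> ('g, 'c, 'q) tfm" where
  "tle t u \<equiv> TEq NatT (monus t u) zero"

abbreviation tiff :: "('g, 'c, 'q) tfm \<Rightarrow> ('g, 'c, 'q) tfm \<Rightarrow> ('g, 'c, 'q) tfm" where
  "tiff A B \<equiv> TAnd (TImp A B) (TImp B A)"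

primrec wf_tfm :: "('g, 'c, 'q, 'z) lang_scheme \<Rightarrow> 'g ty list \<Rightarrow> ('g, 'c, 'q) tfm \<Rightarrow> bool" where
  "wf_tfm L \<Gamma> TBot \<longleftrightarrow> True"
| "wf_tfm L \<Gamma> (TEq \<sigma> t u) \<longleftrightarrow> \<sigma> \<in> types L \<and> has_type L \<Gamma> t \<sigma> \<and> has_type L \<Gamma> u \<sigma>"
| "wf_tfm L \<Gamma> (TMem \<sigma> t u) \<longleftrightarrow>
     \<sigma> \<in> types L \<and> Fin \<sigma> \<in> types L \<and> has_type L \<Gamma> t \<sigma> \<and> has_type L \<Gamma> u (Fin \<sigma>)"
| "wf_tfm L \<Gamma> (TRel q \<tau>s ts) \<longleftrightarrow> (q, \<tau>s) \<in> rels L \<and> list_all2 (has_type L \<Gamma>) ts \<tau>s"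
| "wf_tfm L \<Gamma> (TAnd A B) \<longleftrightarrow> wf_tfm L \<Gamma> A \<and> wf_tfm L \<Gamma> B"
| "wf_tfm L \<Gamma> (TOr A B) \<longleftrightarrow> wf_tfm L \<Gamma> A \<and> wf_tfm L \<Gamma> B"
| "wf_tfm L \<Gamma> (TImp A B) \<longleftrightarrow> wf_tfm L \<Gamma> A \<and> wf_tfm L \<Gamma> B"
| "wf_tfm L \<Gamma> (TAll \<sigma> A) \<longleftrightarrow> \<sigma> \<in> types L \<and> wf_tfm L (\<sigma> # \<Gamma>) A"
| "wf_tfm L \<Gamma> (TEx \<sigma> A) \<longleftrightarrow> \<sigma> \<in> types L \<and> wf_tfm L (\<sigma> # \<Gamma>) A"

primrec sub :: "(nat \<Rightarrow> ('g, 'c) tm) \<Rightarrow> ('g, 'c, 'q) tfm \<Rightarrow> ('g, 'c, 'q) tfm" where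
  "sub s TBot = TBot"
| "sub s (TEq \<sigma> t u) = TEq \<sigma> (tsub s t) (tsub s u)"
| "sub s (TMem \<sigma> t u) = TMem \<sigma> (tsub s t) (tsub s u)"
| "sub s (TRel q \<tau>s ts) = TRel q \<tau>s (map (tsub s) ts)"
| "sub s (TAnd A B) = TAnd (sub s A) (sub s B)"
| "sub s (TOr A B) = TOr (sub s A) (sub s B)"
| "sub s (TImp A B) = TImp (sub s A) (sub s B)"
| "sub s (TAll \<sigma> A) = TAll \<sigma> (sub (up s) A)"
| "sub s (TEx \<sigma> A) = TEx \<sigma> (sub (up s) A)"

primrec talls :: "'g ty list \<Rightarrow> ('g, 'c, 'q) tfm \<Rightarrow> ('g, 'c, 'q) tfm" where
  "talls [] A = A"
| "talls (\<tau> # \<Gamma>) A = talls \<Gamma> (TAll \<tau> A)"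

record ('g, 'c, 'q) target = "('g, 'c, 'q) lang" +
  wtypes :: "'g ty set"
  taxioms :: "('g, 'c, 'q) tfm set"

text \<open>
  \<open>prv T \<Gamma> H A\<close>: the formula \<open>A\<close> of context \<open>\<Gamma>\<close> is derivable from the axioms of \<open>T\<close> and the
  hypotheses \<open>H\<close> in many-sorted intuitionistic logic with equality (natural deduction). A classical
  theory \<open>T\<close> is one whose axioms include the instances of excluded middle.
\<close>

inductive prv :: "('g, 'c, 'q, 'z) target_scheme \<Rightarrow> 'g ty list \<Rightarrow> ('g, 'c, 'q) tfm list \<Rightarrow>
    ('g, 'c, 'q) tfm \<Rightarrow> bool"
  for T :: "('g, 'c, 'q, 'z) target_scheme" where
  ax: "A \<in> taxioms T \<Longrightarrow> prv T \<Gamma> H A"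
| hyp: "A \<in> set H \<Longrightarrow> prv T \<Gamma> H A"
| botE: "prv T \<Gamma> H TBot \<Longrightarrow> wf_tfm T \<Gamma> A \<Longrightarrow> prv T \<Gamma> H A"
| andI: "prv T \<Gamma> H A \<Longrightarrow> prv T \<Gamma> H B \<Longrightarrow> prv T \<Gamma> H (TAnd A B)"
| andE1: "prv T \<Gamma> H (TAnd A B) \<Longrightarrow> prv T \<Gamma> H A"
| andE2: "prv T \<Gamma> H (TAnd A B) \<Longrightarrow> prv T \<Gamma> H B"
| orI1: "prv T \<Gamma> H A \<Longrightarrow> wf_tfm T \<Gamma> B \<Longrightarrow> prv T \<Gamma> H (TOr A B)"
| orI2: "prv T \<Gamma> H B \<Longrightarrow> wf_tfm T \<Gamma> A \<Longrightarrow> prv T \<Gamma> H (TOr A B)"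
| orE: "prv T \<Gamma> H (TOr A B) \<Longrightarrow> prv T \<Gamma> (A # H) C \<Longrightarrow> prv T \<Gamma> (B # H) C \<Longrightarrow> prv T \<Gamma> H C"
| impI: "wf_tfm T \<Gamma> A \<Longrightarrow> prv T \<Gamma> (A # H) B \<Longrightarrow> prv T \<Gamma> H (TImp A B)"
| impE: "prv T \<Gamma> H (TImp A B) \<Longrightarrow> prv T \<Gamma> H A \<Longrightarrow> prv T \<Gamma> H B"
| allI: "\<sigma> \<in> types T \<Longrightarrow> prv T (\<sigma> # \<Gamma>) (map (sub (skip 0)) H) A \<Longrightarrow> prv T \<Gamma> H (TAll \<sigma> A)"
| allE: "prv T \<Gamma> H (TAll \<sigma> A) \<Longrightarrow> has_type T \<Gamma> t \<sigma> \<Longrightarrow> prv T \<Gamma> H (sub (inst [t]) A)"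
| exI: "wf_tfm T \<Gamma> (TEx \<sigma> A) \<Longrightarrow> has_type T \<Gamma> t \<sigma> \<Longrightarrow> prv T \<Gamma> H (sub (inst [t]) A) \<Longrightarrow>
    prv T \<Gamma> H (TEx \<sigma> A)"
| exE: "prv T \<Gamma> H (TEx \<sigma> A) \<Longrightarrow>
    prv T (\<sigma> # \<Gamma>) (A # map (sub (skip 0)) H) (sub (skip 0) C) \<Longrightarrow> wf_tfm T \<Gamma> C \<Longrightarrow> prv T \<Gamma> H C"
| eqI: "\<sigma> \<in> types T \<Longrightarrow> has_type T \<Gamma> t \<sigma> \<Longrightarrow> prv T \<Gamma> H (TEq \<sigma> t t)"
| eqE: "prv T \<Gamma> H (TEq \<sigma> t u) \<Longrightarrow> wf_tfm T (\<sigma> # \<Gamma>) A \<Longrightarrow>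
    prv T \<Gamma> H (sub (inst [t]) A) \<Longrightarrow> prv T \<Gamma> H (sub (inst [u]) A)"

text \<open>
  The elementary facts about the constants of the target language, natural numbers, Booleans
  and finite sets. Reflexivity and transitivity of \<open>\<le>\<close> follow from the recursion equations and
  induction; they are listed for convenience.
\<close>

inductive_set elementary_facts :: "('g, 'c, 'q, 'z) lang_scheme \<Rightarrow> ('g, 'c, 'q) tfm set"
  for T :: "('g, 'c, 'q, 'z) lang_scheme" where
  K: "CK \<sigma> \<tau> \<in> constants T \<Longrightarrow>
    TAll \<sigma> (TAll \<tau> (TEq \<sigma> (Cst (CK \<sigma> \<tau>) \<cdot> Var 1 \<cdot> Var 0) (Var 1))) \<in> elementary_facts T"
| S: "CS \<rho> \<sigma> \<tau> \<in> constants T \<Longrightarrow>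
    TAll (Fun \<rho> (Fun \<sigma> \<tau>)) (TAll (Fun \<rho> \<sigma>) (TAll \<rho>
      (TEq \<tau> (Cst (CS \<rho> \<sigma> \<tau>) \<cdot> Var 2 \<cdot> Var 1 \<cdot> Var 0) (Var 2 \<cdot> Var 0 \<cdot> (Var 1 \<cdot> Var 0)))))
    \<in> elementary_facts T"
| rec_zero: "CRec \<tau> \<in> constants T \<Longrightarrow>
    TAll \<tau> (TAll (Fun NatT (Fun \<tau> \<tau>))
      (TEq \<tau> (Cst (CRec \<tau>) \<cdot> Var 1 \<cdot> Var 0 \<cdot> zero) (Var 1))) \<in> elementary_facts T"
| rec_suc: "CRec \<tau> \<in> constants T \<Longrightarrow>
    TAll \<tau> (TAll (Fun NatT (Fun \<tau> \<tau>)) (TAll NatT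
      (TEq \<tau> (Cst (CRec \<tau>) \<cdot> Var 2 \<cdot> Var 1 \<cdot> suc (Var 0))
             (Var 1 \<cdot> Var 0 \<cdot> (Cst (CRec \<tau>) \<cdot> Var 2 \<cdot> Var 1 \<cdot> Var 0))))) \<in> elementary_facts T"
| cond_true: "CCond \<tau> \<in> constants T \<Longrightarrow>
    TAll \<tau> (TAll \<tau> (TEq \<tau> (Cst (CCond \<tau>) \<cdot> Cst CTrue \<cdot> Var 1 \<cdot> Var 0) (Var 1)))
    \<in> elementary_facts T"
| cond_false: "CCond \<tau> \<in> constants T \<Longrightarrow>
    TAll \<tau> (TAll \<tau> (TEq \<tau> (Cst (CCond \<tau>) \<cdot> Cst CFalse \<cdot> Var 1 \<cdot> Var 0) (Var 0)))
    \<in> elementary_facts T"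
| true_not_false: "TImp (TEq BoolT (Cst CTrue) (Cst CFalse)) TBot \<in> elementary_facts T"
| bool_cases: "TAll BoolT (TOr (TEq BoolT (Var 0) (Cst CTrue)) (TEq BoolT (Var 0) (Cst CFalse)))
    \<in> elementary_facts T"
| suc_inj: "TAll NatT (TAll NatT (TImp (TEq NatT (suc (Var 1)) (suc (Var 0)))
    (TEq NatT (Var 1) (Var 0)))) \<in> elementary_facts T"
| suc_not_zero: "TAll NatT (TImp (TEq NatT (suc (Var 0)) zero) TBot) \<in> elementary_facts T"
| induction: "set \<Gamma> \<subseteq> types T \<Longrightarrow> wf_tfm T (NatT # \<Gamma>) A \<Longrightarrow>
    talls \<Gamma> (TImp (sub (inst [zero]) A)
      (TImp (TAll NatT (TImp A (sub (at0 (suc (Var 0))) A))) (TAll NatT A))) \<in> elementary_facts T"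
| le_refl: "TAll NatT (tle (Var 0) (Var 0)) \<in> elementary_facts T"
| le_trans: "TAll NatT (TAll NatT (TAll NatT
    (TImp (tle (Var 2) (Var 1)) (TImp (tle (Var 1) (Var 0)) (tle (Var 2) (Var 0))))))
    \<in> elementary_facts T"
| set_nonempty: "CSing \<tau> \<in> constants T \<Longrightarrow>
    TAll (Fin \<tau>) (TEx \<tau> (TMem \<tau> (Var 0) (Var 1))) \<in> elementary_facts T"
| mem_sing: "CSing \<tau> \<in> constants T \<Longrightarrow>
    TAll \<tau> (TAll \<tau> (tiff (TMem \<tau> (Var 0) (Cst (CSing \<tau>) \<cdot> Var 1)) (TEq \<tau> (Var 0) (Var 1))))
    \<in> elementary_facts T"
| mem_union: "CUnion \<tau> \<in> constants T \<Longrightarrow>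
    TAll (Fin \<tau>) (TAll (Fin \<tau>) (TAll \<tau> (tiff
      (TMem \<tau> (Var 0) (Cst (CUnion \<tau>) \<cdot> Var 2 \<cdot> Var 1))
      (TOr (TMem \<tau> (Var 0) (Var 2)) (TMem \<tau> (Var 0) (Var 1)))))) \<in> elementary_facts T"
| mem_iunion: "CIUnion \<rho> \<tau> \<in> constants T \<Longrightarrow>
    TAll (Fin \<rho>) (TAll (Fun \<rho> (Fin \<tau>)) (TAll \<tau> (tiff
      (TMem \<tau> (Var 0) (Cst (CIUnion \<rho> \<tau>) \<cdot> Var 2 \<cdot> Var 1))
      (TEx \<rho> (TAnd (TMem \<rho> (Var 0) (Var 3)) (TMem \<tau> (Var 1) (Var 2 \<cdot> Var 0)))))))
    \<in> elementary_facts T"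
| max_mem: "TAll (Fin NatT) (TMem NatT (Cst CMax \<cdot> Var 0) (Var 0)) \<in> elementary_facts T"
| max_ge: "TAll (Fin NatT) (TAll NatT
    (TImp (TMem NatT (Var 0) (Var 1)) (tle (Var 0) (Cst CMax \<cdot> Var 1)))) \<in> elementary_facts T"

text \<open>
  The condition that every witnessing type has a closed term holds automatically for the
  types generated from \<open>NatT\<close>; it is a condition on further witnessing ground types only.
\<close>

definition target_theory :: "('g, 'c, 'r) source \<Rightarrow> ('g, 'c, 'q) target \<Rightarrow> bool" where
  "target_theory S T \<longleftrightarrow>
     lang_ok T \<and>
     types S \<subseteq> types T \<and> constants S \<subseteq> constants T \<and>
     wtypes T \<subseteq> types T \<and> NatT \<in> wtypes T \<and>
     (\<forall>\<rho> \<in> wtypes T. \<forall>\<tau> \<in> wtypes T. Fun \<rho> \<tau> \<in> wtypes T) \<and>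
     (\<forall>\<rho> \<in> wtypes T. Fin \<rho> \<in> wtypes T) \<and>
     (\<forall>\<rho> \<in> wtypes T. \<forall>\<tau> \<in> wtypes T. CK \<rho> \<tau> \<in> constants T) \<and>
     (\<forall>\<rho> \<in> wtypes T. \<forall>\<sigma> \<in> wtypes T. \<forall>\<tau> \<in> wtypes T. CS \<rho> \<sigma> \<tau> \<in> constants T) \<and>
     (\<forall>\<rho> \<in> wtypes T. CRec \<rho> \<in> constants T) \<and>
     (\<forall>\<rho> \<in> wtypes T. CSing \<rho> \<in> constants T \<and> CUnion \<rho> \<in> constants T) \<and>
     (\<forall>\<rho> \<in> wtypes T. \<forall>\<tau> \<in> wtypes T. CIUnion \<rho> \<tau> \<in> constants T) \<and>
     CMax \<in> constants T \<and>
     (\<forall>\<rho> \<in> wtypes T. \<exists>t. has_type T [] t \<rho>) \<and>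
     (\<forall>A \<in> taxioms T. wf_tfm T [] A) \<and>
     (\<forall>A \<in> elementary_facts T. prv T [] [] A)"


section \<open>The extended source language and relativization\<close>

text \<open>
  Relation symbols of the extended language: those of the source and the predicates
  \<open>Inp \<sigma>\<close>. Its formulas have no restricted quantifiers here, since relativization eliminates them.
\<close>

datatype ('g, 'r) isym = Sym 'r "'g ty list" | Inp "'g ty"

fun isym_args :: "('g, 'r) isym \<Rightarrow> 'g ty list" where
  "isym_args (Sym r \<tau>s) = \<tau>s"
| "isym_args (Inp \<sigma>) = [\<sigma>]"

datatype ('g, 'c, 'r) ifm =
    IBot
  | IEq "'g ty" "('g, 'c) tm" "('g, 'c) tm"
  | IRel "('g, 'r) isym" "('g, 'c) tm list"
  | IAnd "('g, 'c, 'r) ifm" "('g, 'c, 'r) ifm"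
  | IImp "('g, 'c, 'r) ifm" "('g, 'c, 'r) ifm"
  | IAll "'g ty" "('g, 'c, 'r) ifm"
  | IEx "'g ty" "('g, 'c, 'r) ifm"

abbreviation IInp :: "'g ty \<Rightarrow> ('g, 'c) tm \<Rightarrow> ('g, 'c, 'r) ifm" where
  "IInp \<sigma> t \<equiv> IRel (Inp \<sigma>) [t]"

primrec relat :: "('g, 'c, 'r) sfm \<Rightarrow> ('g, 'c, 'r) ifm" where
  "relat SBot = IBot"
| "relat (SEq \<sigma> t u) = IEq \<sigma> t u"
| "relat (SRel r \<tau>s ts) = IRel (Sym r \<tau>s) ts"
| "relat (SAnd A B) = IAnd (relat A) (relat B)"
| "relat (SImp A B) = IImp (relat A) (relat B)"
| "relat (SAll \<sigma> A) = IAll \<sigma> (IImp (IInp \<sigma> (Var 0)) (relat A))"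
| "relat (SEx \<sigma> A) = IEx \<sigma> (IAnd (IInp \<sigma> (Var 0)) (relat A))"
| "relat (SRAll \<sigma> B A) = IAll \<sigma> (IImp (relat B) (relat A))"
| "relat (SREx \<sigma> B A) = IEx \<sigma> (IAnd (relat B) (relat A))"

primrec ialls :: "'g ty list \<Rightarrow> ('g, 'c, 'r) ifm \<Rightarrow> ('g, 'c, 'r) ifm" where
  "ialls [] A = A"
| "ialls (\<tau> # \<Gamma>) A = ialls \<Gamma> (IAll \<tau> A)"

fun guard :: "('g, 'c, 'r) ifm list \<Rightarrow> ('g, 'c, 'r) ifm \<Rightarrow> ('g, 'c, 'r) ifm" where
  "guard [] A = A"
| "guard (P # Ps) A = IImp (foldl IAnd P Ps) A"

text \<open>
  For \<open>A\<close> with the tuple \<open>x\<close> of free variables given by \<open>\<Gamma>\<close>: the sentence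
  \<open>\<forall>x (I(x) \<longrightarrow> A)\<close>, where \<open>I(x)\<close> is the conjunction of the \<open>I(x\<^sub>i)\<close> (absent if \<open>x\<close> is empty).
\<close>

definition input_closure :: "'g ty list \<Rightarrow> ('g, 'c, 'r) ifm \<Rightarrow> ('g, 'c, 'r) ifm" where
  "input_closure \<Gamma> A =
     ialls \<Gamma> (guard (map (\<lambda>i. IInp (\<Gamma> ! i) (Var i)) [0..<length \<Gamma>]) A)"


section \<open>The interpretation\<close>

text \<open>
  \<open>brel J p\<close> is the formula \<open>\<langle>p(x)\<rangle>\<close> of the target language in the context \<open>x, c, d\<close> of
  arguments, positive witnesses and negative witnesses.
\<close>

record ('g, 'c, 'r, 'q) base =
  bpos :: "('g, 'r) isym \<Rightarrow> 'g ty list"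
  bneg :: "('g, 'r) isym \<Rightarrow> 'g ty list"
  brel :: "('g, 'r) isym \<Rightarrow> ('g, 'c, 'q) tfm"

definition base_interpretation ::
  "('g, 'c, 'r) source \<Rightarrow> ('g, 'c, 'q) target \<Rightarrow> ('g, 'c, 'r, 'q) base \<Rightarrow> bool" where
  "base_interpretation S T J \<longleftrightarrow>
     (\<forall>p \<in> {Sym r \<tau>s | r \<tau>s. (r, \<tau>s) \<in> rels S} \<union> Inp ` types S.
        set (bpos J p) \<subseteq> wtypes T \<and> set (bneg J p) \<subseteq> wtypes T \<and>
        wf_tfm T (isym_args p @ bpos J p @ bneg J p) (brel J p))"

definition bounding_at_Nat :: "('g, 'c, 'r, 'q) base \<Rightarrow> bool" where
  "bounding_at_Nat J \<longleftrightarrow>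
     bpos J (Inp NatT) = [NatT] \<and> bneg J (Inp NatT) = [] \<and>
     brel J (Inp NatT) = tle (Var 0) (Var 1)"

fun wpos wneg :: "('g, 'c, 'r, 'q) base \<Rightarrow> ('g, 'c, 'r) ifm \<Rightarrow> 'g ty list" where
  "wpos J IBot = []"
| "wpos J (IEq \<sigma> t u) = []"
| "wpos J (IRel p ts) = bpos J p"
| "wpos J (IAnd A B) = wpos J A @ wpos J B"
| "wpos J (IImp A B) =
     map (arrows (wpos J A)) (wpos J B) @
     map (\<lambda>\<tau>. arrows (wpos J A @ wneg J B) (Fin \<tau>)) (wneg J A)"
| "wpos J (IAll \<sigma> A) = wpos J A"
| "wpos J (IEx \<sigma> A) = wpos J A"
| "wneg J IBot = []"
| "wneg J (IEq \<sigma> t u) = []"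
| "wneg J (IRel p ts) = bneg J p"
| "wneg J (IAnd A B) = wneg J A @ wneg J B"
| "wneg J (IImp A B) = wpos J A @ wneg J B"
| "wneg J (IAll \<sigma> A) = wneg J A"
| "wneg J (IEx \<sigma> A) = map Fin (wneg J A)"

text \<open>
  A tuple of \<open>k\<close> bound witnesses is \<open>Var 0, \<dots>, Var (k - 1)\<close>, on top of the ambient context.
  \<open>ball \<tau>s Xs A\<close> is \<open>\<forall>b \<in> Xs. A\<close>, where \<open>A\<close> lives in the context extended by \<open>b\<close> and \<open>Xs\<close> does not.
\<close>

definition bvars :: "nat \<Rightarrow> ('g, 'c) tm list" where
  "bvars k = map Var [0..<k]"

definition ball ::
  "'g ty list \<Rightarrow> ('g, 'c) tm list \<Rightarrow> ('g, 'c, 'q) tfm \<Rightarrow> ('g, 'c, 'q) tfm" where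
  "ball \<tau>s Xs A = talls \<tau>s
     (foldr TImp (map (\<lambda>i. TMem (\<tau>s ! i) (Var i) (lift (length \<tau>s) (Xs ! i))) [0..<length \<tau>s]) A)"

text \<open>
  \<open>uint J e A ps ns\<close> is \<open>\<langle>A\<rangle>\<close> with the terms \<open>ps\<close> for the positive and \<open>ns\<close> for the negative witnesses.
  The environment \<open>e\<close> gives the target terms that stand for the free variables of \<open>A\<close>;
  it keeps track of the shift of these variables under the bound witnesses.
\<close>

primrec uint ::
  "('g, 'c, 'r, 'q) base \<Rightarrow> (nat \<Rightarrow> ('g, 'c) tm) \<Rightarrow> ('g, 'c, 'r) ifm \<Rightarrow>
   ('g, 'c) tm list \<Rightarrow> ('g, 'c) tm list \<Rightarrow> ('g, 'c, 'q) tfm" where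
  "uint J e IBot ps ns = TBot"
| "uint J e (IEq \<sigma> t u) ps ns = TEq \<sigma> (tsub e t) (tsub e u)"
| "uint J e (IRel p ts) ps ns = sub (inst (map (tsub e) ts @ ps @ ns)) (brel J p)"
| "uint J e (IAnd A B) ps ns =
     (let i = length (wpos J A); j = length (wneg J A) in
      TAnd (uint J e A (take i ps) (take j ns)) (uint J e B (drop i ps) (drop j ns)))"
| "uint J e (IImp A B) ps ns =
     (let fs = take (length (wpos J B)) ps; gs = drop (length (wpos J B)) ps;
          as = take (length (wpos J A)) ns; ds = drop (length (wpos J A)) ns;
          k = length (wneg J A) in
      TImp (ball (wneg J A) (map (\<lambda>g. apps g (as @ ds)) gs)
              (uint J (\<lambda>n. lift k (e n)) A (map (lift k) as) (bvars k)))
           (uint J e B (map (\<lambda>f. apps f as) fs) ds))"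
| "uint J e (IAll \<sigma> A) ps ns = TAll \<sigma> (uint J (up e) A (map (lift 1) ps) (map (lift 1) ns))"
| "uint J e (IEx \<sigma> A) ps ns =
     (let k = length (wneg J A) in
      TEx \<sigma> (ball (wneg J A) (map (lift 1) ns)
        (uint J (\<lambda>n. lift k (up e n)) A (map (lift (Suc k)) ps) (bvars k))))"

text \<open>For a formula \<open>A\<close> with free variables in the context \<open>\<Gamma>\<close>.\<close>

definition U_interpretable ::
  "('g, 'c, 'q) target \<Rightarrow> ('g, 'c, 'r, 'q) base \<Rightarrow> 'g ty list \<Rightarrow> ('g, 'c, 'r) ifm \<Rightarrow> bool" where
  "U_interpretable T J \<Gamma> A \<longleftrightarrow>
     (\<exists>ts. list_all2 (has_type T []) ts (wpos J A) \<and>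
       prv T \<Gamma> [] (talls (wneg J A)
         (uint J (\<lambda>n. Var (n + length (wneg J A))) A ts (bvars (length (wneg J A))))))"

definition I_interpretable ::
  "('g, 'c, 'q) target \<Rightarrow> ('g, 'c, 'r, 'q) base \<Rightarrow> 'g ty list \<Rightarrow> ('g, 'c, 'r) sfm \<Rightarrow> bool" where
  "I_interpretable T J \<Gamma> A \<longleftrightarrow> U_interpretable T J [] (input_closure \<Gamma> (relat A))"

definition no_positive_witnesses :: "('g, 'c, 'r, 'q) base \<Rightarrow> ('g, 'c, 'r) sfm \<Rightarrow> bool" where
  "no_positive_witnesses J A \<longleftrightarrow> wpos J (relat A) = []"

text \<open>For a formula \<open>B(x, y)\<close> in the context \<open>\<sigma> # \<tau>s\<close>.\<close>

definition subsumes ::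
  "('g, 'c, 'q) target \<Rightarrow> ('g, 'c, 'r, 'q) base \<Rightarrow> 'g ty \<Rightarrow> 'g ty list \<Rightarrow> ('g, 'c, 'r) sfm \<Rightarrow> bool"
  where
  "subsumes T J \<sigma> \<tau>s B \<longleftrightarrow>
     U_interpretable T J [] (input_closure \<tau>s (IAll \<sigma> (IImp (relat B) (IInp \<sigma> (Var 0)))))"

definition semi_uniform ::
  "('g, 'c, 'q) target \<Rightarrow> ('g, 'c, 'r, 'q) base \<Rightarrow> 'g ty \<Rightarrow> 'g ty list \<Rightarrow> ('g, 'c, 'r) sfm \<Rightarrow> bool"
  where
  "semi_uniform T J \<sigma> \<tau>s B \<longleftrightarrow> subsumes T J \<sigma> \<tau>s B \<and> no_positive_witnesses J B"

end

theory Submission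
  imports Defs
begin

text \<open>
  A negative witness of the conclusion is a tuple of finite sets \<open>b\<close>, \<open>N\<close>, \<open>c\<close>, where the set \<open>N\<close>
  of numbers bounds the universally quantified \<open>n\<close>. Since \<open>B\<close> and \<open>C\<close> have no positive witnesses,
  neither has the principle beyond the sets at which its premise is used, and for these the
  singletons of \<open>max N\<close>, \<open>b\<close> and \<open>c\<close> suffice: the premise at \<open>k = max N\<close> yields an \<open>x\<close> such that
  all instances of \<open>C(x, n)\<close> at \<open>c\<close> with \<open>n \<le> max N\<close> hold, hence those with \<open>n \<le> m\<close> for some \<open>m \<in> N\<close>.
\<close>

section \<open>Substitution\<close>

text \<open>Why the witness tuples fit together: relativization turns the quantifier over n in the
  conclusion into an implication from I(n). The bound of n, positive for I(n), is negative for the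
  implication, and the existential quantifier over x replaces it by a finite set, hence N. The
  bounded quantifier relativizes to n \<le> k itself and adds no witness, whereas k adds its own
  bound. So the negative witnesses of premise and conclusion agree in type up to order, except for a
  number on one side against a finite set of numbers on the other; the maximum functional translates
  between them. The x supplied by the premise is itself the x of the conclusion, and it serves all
  members of N at once. The obstacle is the form of the realizers: they are closed terms in a
  language without abstraction and take further arguments, the witnesses of the inputs y and z. They
  are therefore assembled from K and S and are known only up to provable equality. For this reason
  the realization argument asks for no particular terms, only for sets that provably contain max N,
  b and c.\<close>

definition scons :: "('g, 'c) tm \<Rightarrow> (nat \<Rightarrow> ('g, 'c) tm) \<Rightarrow> nat \<Rightarrow> ('g, 'c) tm" (infixr "##" 65) where
  "(t ## s) n = (case n of 0 \<Rightarrow> t | Suc m \<Rightarrow> s m)"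

lemma scons_simps [simp]: "(t ## s) 0 = t" "(t ## s) (Suc n) = s n"
  by (simp_all add: scons_def)

text \<open>Closed form of the k-fold iterate of \<open>up\<close> (see \<open>up_ups\<close>),
  needed because a whole tuple of witnesses is bound at once.\<close>

definition ups :: "nat \<Rightarrow> (nat \<Rightarrow> ('g, 'c) tm) \<Rightarrow> nat \<Rightarrow> ('g, 'c) tm" where
  "ups k s n = (if n < k then Var n else lift k (s (n - k)))"

text \<open>Together with \<open>sub_sub\<close> this fuses nested substitutions into one, so that
  identities between substituted formulas reduce to identities between functions on indices.\<close>

lemma tsub_tsub [simp]: "tsub s (tsub t u) = tsub (\<lambda>n. tsub s (t n)) u"
  by (induction u) auto

lemma tsub_Var [simp]: "tsub Var t = t"
  by (induction t) auto

lemma lift_Var [simp]: "lift k (Var n) = Var (n + k)"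
  and lift_Cst [simp]: "lift k (Cst c) = Cst c"
  and lift_App [simp]: "lift k (t \<cdot> u) = lift k t \<cdot> lift k u"
  by (simp_all add: lift_def)

lemma lift_0 [simp]: "lift 0 t = t"
  by (simp add: lift_def)

lemma map_lift_0 [simp]: "map (lift 0) ts = ts"
  by (simp add: map_idI)

lemma lift_lift [simp]: "lift i (lift j t) = lift (i + j) t"
  by (simp add: lift_def add_ac)

lemma tsub_lift: "tsub s (lift k t) = tsub (\<lambda>n. s (n + k)) t"
  by (simp add: lift_def)

lemma lift_tsub: "lift k (tsub s t) = tsub (\<lambda>n. lift k (s n)) t"
  by (simp add: lift_def)

lemma up_eq: "up s = Var 0 ## (\<lambda>n. lift 1 (s n))"
  by (auto simp: fun_eq_iff up_def scons_def split: nat.split)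

lemma up_simps [simp]: "up s 0 = Var 0" "up s (Suc n) = lift (Suc 0) (s n)"
  by (simp_all add: up_def)

lemma ups_0 [simp]: "ups 0 s = s"
  by (simp add: fun_eq_iff ups_def)

lemma up_ups: "up (ups k s) = ups (Suc k) s"
  by (auto simp: fun_eq_iff ups_def up_def split: nat.split)

lemma up_Var [simp]: "up Var = Var"
  by (simp add: fun_eq_iff up_def split: nat.split)

lemma tsub_ups_lift [simp]: "tsub (ups k s) (lift k t) = lift k (tsub s t)"
  by (simp add: tsub_lift lift_tsub ups_def)

lemma tsub_up_lift [simp]: "tsub (up s) (lift (Suc 0) t) = lift (Suc 0) (tsub s t)"
  by (simp add: tsub_lift lift_tsub)

lemma tsub_up_up [simp]: "tsub (up s) (up t n) = up (\<lambda>n. tsub s (t n)) n"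
  by (cases n) simp_all

lemma tsub_inst_lift [simp]: "length ts = k \<Longrightarrow> tsub (inst ts) (lift k t) = t"
  by (auto simp: tsub_lift inst_def)

lemma tsub_inst_up [simp]: "tsub (inst [t]) (up s n) = (t ## s) n"
  by (cases n) (simp_all add: inst_def[of "[t]" 0])

lemma tsub_scons: "tsub s ((t ## r) n) = (tsub s t ## (\<lambda>m. tsub s (r m))) n"
  by (cases n) simp_all

lemma skip_0: "skip 0 = (\<lambda>n. Var (n + 1))"
  by (simp add: skip_def fun_eq_iff)

lemma tsub_skip_0 [simp]: "tsub (skip 0) = lift (Suc 0)"
  by (simp add: skip_0 lift_def)

lemma tsub_shift_Suc: "tsub (\<lambda>n. Var (Suc (n + k))) t = lift (Suc k) t"
  by (simp add: lift_def)

lemma tsub_apps [simp]: "tsub s (apps t us) = apps (tsub s t) (map (tsub s) us)"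
  by (induction us arbitrary: t) (simp_all add: apps_def)

lemma apps_append: "apps t (us @ vs) = apps (apps t us) vs"
  by (simp add: apps_def)

lemma apps_Nil [simp]: "apps t [] = t"
  and apps_Cons [simp]: "apps t (u # us) = apps (t \<cdot> u) us"
  by (simp_all add: apps_def)

lemma arrows_Nil [simp]: "arrows [] \<tau> = \<tau>"
  and arrows_Cons [simp]: "arrows (\<sigma> # \<sigma>s) \<tau> = Fun \<sigma> (arrows \<sigma>s \<tau>)"
  and arrows_append: "arrows (\<sigma>s @ \<rho>s) \<tau> = arrows \<sigma>s (arrows \<rho>s \<tau>)"
  by (simp_all add: arrows_def)

lemma tsub_pred_tm [simp]: "tsub s pred_tm = pred_tm"
  by (simp add: pred_tm_def)

lemma tsub_monus [simp]: "tsub s (monus t u) = monus (tsub s t) (tsub s u)"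
  by (simp add: monus_def)

lemma length_bvars [simp]: "length (bvars k) = k"
  by (simp add: bvars_def)

lemma map_tsub_ups_bvars [simp]: "map (tsub (ups k s)) (bvars k) = bvars k"
  by (simp add: bvars_def ups_def)

lemma map_tsub_inst_bvars [simp]: "length ts = k \<Longrightarrow> map (tsub (inst ts)) (bvars k) = ts"
  by (auto simp: bvars_def inst_def intro: nth_equalityI)

lemma sub_sub [simp]: "sub s (sub t A) = sub (\<lambda>n. tsub s (t n)) A"
  by (induction A arbitrary: s t) auto

lemma sub_Var [simp]: "sub Var A = A"
  by (induction A) (auto simp: map_idI)

lemma sub_talls: "sub s (talls \<tau>s A) = talls \<tau>s (sub (ups (length \<tau>s) s) A)"
  by (induction \<tau>s arbitrary: A) (simp_all add: up_ups)

lemma sub_foldr_TImp: "sub s (foldr TImp Hs A) = foldr TImp (map (sub s) Hs) (sub s A)"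
  by (induction Hs) simp_all

lemma sub_ball:
  "length Xs = length \<tau>s \<Longrightarrow>
    sub s (ball \<tau>s Xs A) = ball \<tau>s (map (tsub s) Xs) (sub (ups (length \<tau>s) s) A)"
  by (auto simp: ball_def sub_talls sub_foldr_TImp ups_def
      intro!: arg_cong[where f="talls \<tau>s"] arg_cong2[where f="foldr TImp"])

lemma ball_Nil [simp]: "ball [] Xs A = A"
  by (simp add: ball_def)


section \<open>Typing\<close>

text \<open>Only the indices inside the context are constrained, so that total functions such as
  \<open>inst ts\<close> and \<open>skip j\<close> can serve as environments.\<close>

definition env_typed ::
  "('g, 'c, 's, 'z) lang_scheme \<Rightarrow> 'g ty list \<Rightarrow> (nat \<Rightarrow> ('g, 'c) tm) \<Rightarrow> 'g ty list \<Rightarrow> bool" where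
  "env_typed L \<Delta> e \<Gamma> \<longleftrightarrow> (\<forall>n < length \<Gamma>. has_type L \<Delta> (e n) (\<Gamma> ! n))"

lemma has_type_tsub:
  "has_type L \<Gamma> t \<tau> \<Longrightarrow> env_typed L \<Delta> e \<Gamma> \<Longrightarrow> has_type L \<Delta> (tsub e t) \<tau>"
  by (induction t arbitrary: \<tau>) (auto simp: env_typed_def)

lemma has_type_lift [intro]:
  "has_type L \<Gamma> t \<tau> \<Longrightarrow> length \<Delta> = k \<Longrightarrow> has_type L (\<Delta> @ \<Gamma>) (lift k t) \<tau>"
  unfolding lift_def by (rule has_type_tsub) (auto simp: env_typed_def nth_append)

lemma has_type_lift1 [intro]: "has_type L \<Gamma> t \<tau> \<Longrightarrow> has_type L (\<sigma> # \<Gamma>) (lift (Suc 0) t) \<tau>"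
  using has_type_lift[of L \<Gamma> t \<tau> "[\<sigma>]" "Suc 0"] by simp

lemma has_type_lift_map:
  "list_all2 (has_type L \<Gamma>) ts \<tau>s \<Longrightarrow> length \<Delta> = k \<Longrightarrow>
    list_all2 (has_type L (\<Delta> @ \<Gamma>)) (map (lift k) ts) \<tau>s"
  by (auto simp: list_all2_conv_all_nth)

lemma has_type_lift1_map:
  "list_all2 (has_type L \<Gamma>) ts \<tau>s \<Longrightarrow>
    list_all2 (has_type L (\<sigma> # \<Gamma>)) (map (lift (Suc 0)) ts) \<tau>s"
  by (auto simp: list_all2_conv_all_nth)

lemma has_type_extend: "has_type L \<Gamma> t \<tau> \<Longrightarrow> has_type L (\<Gamma> @ \<Delta>) t \<tau>"
  by (induction t arbitrary: \<tau>) (auto simp: nth_append)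

lemma has_type_closed: "has_type L [] t \<tau> \<Longrightarrow> has_type L \<Gamma> t \<tau>"
  using has_type_extend[of L "[]" t \<tau> \<Gamma>] by simp

lemma tsub_closed: "has_type L [] t \<tau> \<Longrightarrow> tsub s t = t"
  by (induction t arbitrary: \<tau>) auto

lemma lift_closed: "has_type L [] t \<tau> \<Longrightarrow> lift k t = t"
  unfolding lift_def by (rule tsub_closed)

lemma has_type_apps:
  "list_all2 (has_type L \<Gamma>) us \<sigma>s \<Longrightarrow> has_type L \<Gamma> t (arrows \<sigma>s \<tau>) \<Longrightarrow>
    has_type L \<Gamma> (apps t us) \<tau>"
proof (induction us \<sigma>s arbitrary: t rule: list_all2_induct)
  case (Cons u us \<sigma> \<sigma>s)
  then have "has_type L \<Gamma> (t \<cdot> u) (arrows \<sigma>s \<tau>)" by auto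
  then show ?case using Cons.IH by simp
qed simp

lemma has_type_closed_map:
  "list_all2 (has_type L []) ts \<tau>s \<Longrightarrow> list_all2 (has_type L \<Gamma>) ts \<tau>s"
  by (auto elim!: list_all2_mono intro: has_type_closed)

lemma has_type_map_apps:
  assumes "list_all2 (has_type L \<Gamma>) us \<sigma>s" "list_all2 (has_type L \<Gamma>) ts (map (arrows \<sigma>s) \<tau>s)"
  shows "list_all2 (has_type L \<Gamma>) (map (\<lambda>t. apps t us) ts) \<tau>s"
  using assms(2) has_type_apps[OF assms(1)] by (auto simp: list_all2_conv_all_nth[of _ _ "map _ _"]
      list_all2_conv_all_nth[of _ "map _ _"])

lemma has_type_bvars: "list_all2 (has_type L (\<tau>s @ \<Gamma>)) (bvars (length \<tau>s)) \<tau>s"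
  by (auto simp: bvars_def list_all2_conv_all_nth nth_append)

lemma env_typed_scons:
  "has_type L \<Delta> t \<sigma> \<Longrightarrow> env_typed L \<Delta> e \<Gamma> \<Longrightarrow> env_typed L \<Delta> (t ## e) (\<sigma> # \<Gamma>)"
  by (auto simp: env_typed_def scons_def nth_Cons split: nat.split)

lemma env_typed_lift:
  "env_typed L \<Delta> e \<Gamma> \<Longrightarrow> length \<Delta>' = k \<Longrightarrow> env_typed L (\<Delta>' @ \<Delta>) (\<lambda>n. lift k (e n)) \<Gamma>"
  by (auto simp: env_typed_def)

lemma env_typed_up: "env_typed L \<Delta> e \<Gamma> \<Longrightarrow> env_typed L (\<sigma> # \<Delta>) (up e) (\<sigma> # \<Gamma>)"
  unfolding up_eq by (rule env_typed_scons) (auto simp: env_typed_def)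

lemma env_typed_inst:
  "list_all2 (has_type L \<Gamma>) ts \<tau>s \<Longrightarrow> env_typed L \<Gamma> (inst ts) \<tau>s"
  by (auto simp: env_typed_def list_all2_conv_all_nth inst_def)

lemma has_type_tsub_map:
  "list_all2 (has_type L \<Gamma>) ts \<tau>s \<Longrightarrow> env_typed L \<Delta> e \<Gamma> \<Longrightarrow>
    list_all2 (has_type L \<Delta>) (map (tsub e) ts) \<tau>s"
  by (auto simp: list_all2_conv_all_nth intro: has_type_tsub)

lemma wf_tfm_sub: "wf_tfm L \<Gamma> A \<Longrightarrow> env_typed L \<Delta> e \<Gamma> \<Longrightarrow> wf_tfm L \<Delta> (sub e A)"
  by (induction A arbitrary: \<Gamma> \<Delta> e) (auto intro: has_type_tsub has_type_tsub_map env_typed_up)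

lemma wf_sfm_ssub: "wf_sfm L \<Gamma> A \<Longrightarrow> env_typed L \<Delta> e \<Gamma> \<Longrightarrow> wf_sfm L \<Delta> (ssub e A)"
proof (induction A arbitrary: \<Gamma> \<Delta> e)
  case (SRAll \<sigma> B A)
  note * = env_typed_up[OF SRAll.prems(2), of \<sigma>]
  show ?case using SRAll.IH(1)[OF _ *] SRAll.IH(2)[OF _ *] SRAll.prems(1) by simp
next
  case (SREx \<sigma> B A)
  note * = env_typed_up[OF SREx.prems(2), of \<sigma>]
  show ?case using SREx.IH(1)[OF _ *] SREx.IH(2)[OF _ *] SREx.prems(1) by simp
qed (auto intro: has_type_tsub has_type_tsub_map env_typed_up)

lemma wf_tfm_extend: "wf_tfm L \<Gamma> A \<Longrightarrow> wf_tfm L (\<Gamma> @ \<Delta>) A"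
proof (induction A arbitrary: \<Gamma>)
  case (TAll \<sigma> A)
  then show ?case using TAll.IH[of "\<sigma> # \<Gamma>"] by simp
next
  case (TEx \<sigma> A)
  then show ?case using TEx.IH[of "\<sigma> # \<Gamma>"] by simp
qed (auto intro: has_type_extend list_all2_mono)

lemma tsub_cong: "has_type L \<Gamma> t \<tau> \<Longrightarrow> (\<And>n. n < length \<Gamma> \<Longrightarrow> s n = r n) \<Longrightarrow> tsub s t = tsub r t"
  by (induction t arbitrary: \<tau>) auto

text \<open>Serves the atomic case of \<open>sub_uint\<close>: there two environments agree only
  below the number of arguments and witnesses, and \<open>brel J p\<close> is well-formed in exactly
  that context.\<close>

lemma sub_cong:
  assumes "wf_tfm L \<Gamma> A" and "\<And>n. n < length \<Gamma> \<Longrightarrow> s n = r n"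
  shows "sub s A = sub r A"
  using assms
proof (induction A arbitrary: \<Gamma> s r)
  case (TEq \<sigma> t u)
  note tsub_cong[of L \<Gamma> _ \<sigma> s r]
  with TEq show ?case by (metis sub.simps(2) wf_tfm.simps(2))
next
  case (TMem \<sigma> t u)
  note tsub_cong[of L \<Gamma> _ _ s r]
  with TMem show ?case by (metis sub.simps(3) wf_tfm.simps(3))
next
  case (TRel q \<tau>s ts)
  have "tsub s t = tsub r t" if "t \<in> set ts" for t
    using that TRel.prems tsub_cong[of L \<Gamma> t _ s r]
    by (fastforce simp: list_all2_conv_all_nth in_set_conv_nth)
  then show ?case by simp
next
  case (TAll \<sigma> A)
  have "sub (up s) A = sub (up r) A"
    by (rule TAll.IH) (use TAll.prems in \<open>auto simp: up_def split: nat.split\<close>)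
  then show ?case by simp
next
  case (TEx \<sigma> A)
  have "sub (up s) A = sub (up r) A"
    by (rule TEx.IH) (use TEx.prems in \<open>auto simp: up_def split: nat.split\<close>)
  then show ?case by simp
qed (simp_all, metis+)

lemma wf_talls: "wf_tfm L \<Gamma> (talls \<tau>s A) \<longleftrightarrow> set \<tau>s \<subseteq> types L \<and> wf_tfm L (\<tau>s @ \<Gamma>) A"
  by (induction \<tau>s arbitrary: A) auto

lemma wf_foldr_TImp:
  "wf_tfm L \<Gamma> (foldr TImp Hs A) \<longleftrightarrow> (\<forall>X \<in> set Hs. wf_tfm L \<Gamma> X) \<and> wf_tfm L \<Gamma> A"
  by (induction Hs) auto

text \<open>The membership premises of \<open>ball\<close> are separated from the quantifier block
  so that they can be moved into the hypotheses of a derivation.\<close>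

definition ball_hyps :: "'g ty list \<Rightarrow> ('g, 'c) tm list \<Rightarrow> ('g, 'c, 'q) tfm list" where
  "ball_hyps \<tau>s Xs =
     map (\<lambda>i. TMem (\<tau>s ! i) (Var i) (lift (length \<tau>s) (Xs ! i))) [0..<length \<tau>s]"

lemma ball_alt: "ball \<tau>s Xs A = talls \<tau>s (foldr TImp (ball_hyps \<tau>s Xs) A)"
  by (simp add: ball_def ball_hyps_def)

lemma wf_ball_hyps:
  assumes "set \<tau>s \<subseteq> types L" "Fin ` set \<tau>s \<subseteq> types L"
    and "list_all2 (has_type L \<Gamma>) Xs (map Fin \<tau>s)" "X \<in> set (ball_hyps \<tau>s Xs)"
  shows "wf_tfm L (\<tau>s @ \<Gamma>) X"
  using assms
  by (auto simp: ball_hyps_def list_all2_conv_all_nth nth_append subset_iff image_iff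
      intro!: has_type_lift)

lemma wf_ball:
  assumes "set \<tau>s \<subseteq> types L" "Fin ` set \<tau>s \<subseteq> types L"
    and "list_all2 (has_type L \<Gamma>) Xs (map Fin \<tau>s)" "wf_tfm L (\<tau>s @ \<Gamma>) A"
  shows "wf_tfm L \<Gamma> (ball \<tau>s Xs A)"
  using assms wf_ball_hyps[OF assms(1-3)] by (simp add: ball_alt wf_talls wf_foldr_TImp)


section \<open>The target calculus\<close>

lemma prv_weaken: "prv T \<Gamma> H A \<Longrightarrow> set H \<subseteq> set H' \<Longrightarrow> prv T \<Gamma> H' A"
proof (induction arbitrary: H' rule: prv.induct)
  case (orE \<Gamma> H A B C)
  show ?case
    by (rule prv.orE[OF orE.IH(1)[OF orE.prems] orE.IH(2) orE.IH(3)]) (use orE.prems in auto)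
next
  case (impI \<Gamma> A H B)
  show ?case by (rule prv.impI[OF impI.hyps(1) impI.IH]) (use impI.prems in auto)
next
  case (allI \<sigma> \<Gamma> H A)
  show ?case by (rule prv.allI[OF allI.hyps(1) allI.IH]) (use allI.prems in auto)
next
  case (exE \<Gamma> H \<sigma> A C)
  show ?case by (rule prv.exE[OF exE.IH(1)[OF exE.prems] exE.IH(2) exE.hyps(3)]) (use exE.prems in auto)
next
  case (eqE \<Gamma> H \<sigma> t u A)
  show ?case
    by (rule prv.eqE[OF eqE.IH(1)[OF eqE.prems] eqE.hyps(2) eqE.IH(2)[OF eqE.prems]])
qed (auto intro: prv.intros)

text \<open>Extending the context at its end leaves all indices unchanged, so no substitution is needed.\<close>

lemma prv_extend: "prv T \<Gamma> H A \<Longrightarrow> prv T (\<Gamma> @ \<Delta>) H A"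
proof (induction rule: prv.induct)
  case (exI \<Gamma> \<sigma> A t H)
  show ?case
    by (rule prv.exI[OF wf_tfm_extend[OF exI.hyps(1)] has_type_extend[OF exI.hyps(2)] exI.IH])
next
  case (eqE \<Gamma> H \<sigma> t u A)
  show ?case
    using wf_tfm_extend[OF eqE.hyps(2), of \<Delta>] by (intro prv.eqE[OF eqE.IH(1) _ eqE.IH(2)]) simp
qed (auto intro: prv.intros wf_tfm_extend has_type_extend)

lemma prv_closed: "prv T [] [] A \<Longrightarrow> prv T \<Gamma> H A"
  using prv_weaken[of T \<Gamma> "[]" A H] prv_extend[of T "[]" "[]" A \<Gamma>] by simp

lemma map_sub_Var [simp]: "map (sub Var) H = H"
  by (simp add: map_idI)

lemma prv_tallsI:
  assumes "set \<tau>s \<subseteq> types T"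
    and "prv T (\<tau>s @ \<Gamma>) (map (sub (\<lambda>n. Var (n + length \<tau>s))) H) A"
  shows "prv T \<Gamma> H (talls \<tau>s A)"
  using assms
proof (induction \<tau>s arbitrary: A)
  case (Cons \<tau> \<tau>s)
  have "prv T (\<tau>s @ \<Gamma>) (map (sub (\<lambda>n. Var (n + length \<tau>s))) H) (TAll \<tau> A)"
    using Cons.prems by (intro prv.allI) (auto simp: comp_def skip_def)
  then show ?case using Cons by simp
qed simp

lemma inst_Cons: "inst (t # ts) n = (t ## inst ts) n"
  by (cases n) (simp_all add: inst_def)

lemma sub_inst_Nil: "sub (inst []) (A :: ('g, 'c, 'q) tfm) = A"
proof -
  have "inst [] = (Var :: nat \<Rightarrow> ('g, 'c) tm)" by (simp add: fun_eq_iff inst_def)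
  then show ?thesis by simp
qed

text \<open>The head of the list is the innermost quantifier, so the tail is instantiated first; the
  head is then instantiated in a body under \<open>up (inst ts)\<close>, and the two substitutions
  fuse to \<open>inst (t # ts)\<close>.\<close>

lemma prv_tallsE:
  assumes "prv T \<Gamma> H (talls \<tau>s A)" and "list_all2 (has_type T \<Gamma>) ts \<tau>s"
  shows "prv T \<Gamma> H (sub (inst ts) A)"
  using assms(2,1)
proof (induction ts \<tau>s arbitrary: A rule: list_all2_induct)
  case Nil
  then show ?case by (simp add: sub_inst_Nil)
next
  case (Cons t ts \<tau> \<tau>s)
  have "prv T \<Gamma> H (TAll \<tau> (sub (up (inst ts)) A))"
    using Cons.IH[of "TAll \<tau> A"] Cons.prems by simp
  from prv.allE[OF this Cons.hyps(1)] show ?case by (simp flip: inst_Cons)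
qed

lemma prv_foldr_TImpI:
  assumes "\<And>X. X \<in> set Xs \<Longrightarrow> wf_tfm T \<Gamma> X" and "prv T \<Gamma> (Xs @ H) A"
  shows "prv T \<Gamma> H (foldr TImp Xs A)"
  using assms
proof (induction Xs arbitrary: H)
  case (Cons X Xs)
  have "prv T \<Gamma> (X # H) (foldr TImp Xs A)"
    using Cons.prems(1) by (intro Cons.IH prv_weaken[OF Cons.prems(2)]) auto
  then show ?case using Cons.prems(1) by (auto intro: prv.impI)
qed simp

lemma prv_foldr_TImpE:
  assumes "prv T \<Gamma> H (foldr TImp Xs A)" and "\<And>X. X \<in> set Xs \<Longrightarrow> prv T \<Gamma> H X"
  shows "prv T \<Gamma> H A"
  using assms by (induction Xs) (auto intro: prv.impE)

lemma prv_ballI: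
  assumes "set \<tau>s \<subseteq> types T" "Fin ` set \<tau>s \<subseteq> types T"
    and "list_all2 (has_type T \<Gamma>) Xs (map Fin \<tau>s)"
    and "prv T (\<tau>s @ \<Gamma>) (ball_hyps \<tau>s Xs @ map (sub (\<lambda>n. Var (n + length \<tau>s))) H) A"
  shows "prv T \<Gamma> H (ball \<tau>s Xs A)"
  unfolding ball_alt using assms wf_ball_hyps[OF assms(1-3)]
  by (intro prv_tallsI prv_foldr_TImpI) auto

lemma prv_ballE:
  assumes "prv T \<Gamma> H (ball \<tau>s Xs A)" and "list_all2 (has_type T \<Gamma>) ts \<tau>s"
    and "\<And>i. i < length \<tau>s \<Longrightarrow> prv T \<Gamma> H (TMem (\<tau>s ! i) (ts ! i) (Xs ! i))"
  shows "prv T \<Gamma> H (sub (inst ts) A)"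
proof (rule prv_foldr_TImpE)
  show "prv T \<Gamma> H (foldr TImp (map (sub (inst ts)) (ball_hyps \<tau>s Xs)) (sub (inst ts) A))"
    using prv_tallsE[OF assms(1)[unfolded ball_alt] assms(2)] by (simp add: sub_foldr_TImp)
next
  show "prv T \<Gamma> H X" if "X \<in> set (map (sub (inst ts)) (ball_hyps \<tau>s Xs))" for X
  proof -
  from that obtain i where i: "i < length \<tau>s"
    and X: "X = sub (inst ts) (TMem (\<tau>s ! i) (Var i) (lift (length \<tau>s) (Xs ! i)))"
    by (auto simp: ball_hyps_def)
  have "length ts = length \<tau>s" using assms(2) by (rule list_all2_lengthD)
  with i X have "X = TMem (\<tau>s ! i) (ts ! i) (Xs ! i)" by (simp add: inst_def)
  with assms(3)[OF i] show ?thesis by simp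
  qed
qed

section \<open>Derived rules for equality, each an instance of Leibniz's rule
  \<open>eqE\<close>\<close>

lemma prv_eq_sym:
  assumes "prv T \<Gamma> H (TEq \<sigma> t u)" "\<sigma> \<in> types T" "has_type T \<Gamma> t \<sigma>"
  shows "prv T \<Gamma> H (TEq \<sigma> u t)"
  using prv.eqE[OF assms(1), of "TEq \<sigma> (Var 0) (lift 1 t)"] assms
  by (auto simp: inst_def intro: prv.eqI)

lemma prv_eq_trans:
  assumes "prv T \<Gamma> H (TEq \<sigma> t u)" "prv T \<Gamma> H (TEq \<sigma> u v)" "\<sigma> \<in> types T" "has_type T \<Gamma> t \<sigma>"
  shows "prv T \<Gamma> H (TEq \<sigma> t v)"
  using prv.eqE[OF assms(2), of "TEq \<sigma> (lift 1 t) (Var 0)"] assms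
  by (auto simp: inst_def)

lemma prv_eq_app:
  assumes "prv T \<Gamma> H (TEq (Fun \<sigma> \<tau>) t u)" "\<tau> \<in> types T"
    and "has_type T \<Gamma> t (Fun \<sigma> \<tau>)" "has_type T \<Gamma> a \<sigma>"
  shows "prv T \<Gamma> H (TEq \<tau> (t \<cdot> a) (u \<cdot> a))"
proof -
  have "wf_tfm T (Fun \<sigma> \<tau> # \<Gamma>) (TEq \<tau> (lift 1 (t \<cdot> a)) (Var 0 \<cdot> lift 1 a))"
    using assms(2-4) by auto
  moreover have "prv T \<Gamma> H (TEq \<tau> (t \<cdot> a) (t \<cdot> a))"
    using assms(2-4) by (intro prv.eqI) auto
  ultimately show ?thesis using prv.eqE[OF assms(1)] by (fastforce simp: inst_def)
qed

lemma prv_mem_eq: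
  assumes "prv T \<Gamma> H (TEq (Fin \<tau>) X Y)" "prv T \<Gamma> H (TMem \<tau> t X)"
    and "\<tau> \<in> types T" "Fin \<tau> \<in> types T" "has_type T \<Gamma> t \<tau>"
  shows "prv T \<Gamma> H (TMem \<tau> t Y)"
  using prv.eqE[OF assms(1), of "TMem \<tau> (lift 1 t) (Var 0)"] assms
  by (auto simp: inst_def)


section \<open>The interpretation\<close>

primrec wf_ifm :: "('g, 'c, 'r, 'z) lang_scheme \<Rightarrow> 'g ty list \<Rightarrow> ('g, 'c, 'r) ifm \<Rightarrow> bool" where
  "wf_ifm L \<Gamma> IBot \<longleftrightarrow> True"
| "wf_ifm L \<Gamma> (IEq \<sigma> t u) \<longleftrightarrow> \<sigma> \<in> types L \<and> has_type L \<Gamma> t \<sigma> \<and> has_type L \<Gamma> u \<sigma>"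
| "wf_ifm L \<Gamma> (IRel p ts) \<longleftrightarrow>
     p \<in> {Sym r \<tau>s | r \<tau>s. (r, \<tau>s) \<in> rels L} \<union> Inp ` types L \<and>
     list_all2 (has_type L \<Gamma>) ts (isym_args p)"
| "wf_ifm L \<Gamma> (IAnd A B) \<longleftrightarrow> wf_ifm L \<Gamma> A \<and> wf_ifm L \<Gamma> B"
| "wf_ifm L \<Gamma> (IImp A B) \<longleftrightarrow> wf_ifm L \<Gamma> A \<and> wf_ifm L \<Gamma> B"
| "wf_ifm L \<Gamma> (IAll \<sigma> A) \<longleftrightarrow> \<sigma> \<in> types L \<and> wf_ifm L (\<sigma> # \<Gamma>) A"
| "wf_ifm L \<Gamma> (IEx \<sigma> A) \<longleftrightarrow> \<sigma> \<in> types L \<and> wf_ifm L (\<sigma> # \<Gamma>) A"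

lemma wf_relat: "wf_sfm L \<Gamma> A \<Longrightarrow> wf_ifm L \<Gamma> (relat A)"
  by (induction A arbitrary: \<Gamma>) auto

lemma wpos_relat_ssub [simp]: "wpos J (relat (ssub s A)) = wpos J (relat A)"
  and wneg_relat_ssub [simp]: "wneg J (relat (ssub s A)) = wneg J (relat A)"
  by (induction A arbitrary: s) auto

text \<open>The environment is consulted only at terms, so a source substitution can be absorbed
  into it. This identifies the copies of B and C under \<open>skip\<close> in the premise with B and
  C in the conclusion.\<close>

lemma uint_relat_ssub:
  "uint J e (relat (ssub s A)) ps ns = uint J (\<lambda>n. tsub e (s n)) (relat A) ps ns"
  by (induction A arbitrary: s e ps ns)
    (simp_all add: Let_def comp_def flip: lift_tsub)

lemma uint_ialls:
  "uint J e (ialls \<Gamma> A) ps ns =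
     talls \<Gamma> (uint J (ups (length \<Gamma>) e) A (map (lift (length \<Gamma>)) ps) (map (lift (length \<Gamma>)) ns))"
  by (induction \<Gamma> arbitrary: A) (simp_all add: up_ups comp_def)

lemma wpos_ialls [simp]: "wpos J (ialls \<Gamma> A) = wpos J A"
  and wneg_ialls [simp]: "wneg J (ialls \<Gamma> A) = wneg J A"
  by (induction \<Gamma> arbitrary: A) simp_all


text \<open>The part common to the clauses for implication and existential quantification: A at
  positive witnesses \<open>ps\<close> and at all negative witnesses from the finite sets
  \<open>Xs\<close>.\<close>

definition uball ::
  "('g, 'c, 'r, 'q) base \<Rightarrow> (nat \<Rightarrow> ('g, 'c) tm) \<Rightarrow> ('g, 'c, 'r) ifm \<Rightarrow>
   ('g, 'c) tm list \<Rightarrow> ('g, 'c) tm list \<Rightarrow> ('g, 'c, 'q) tfm" where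
  "uball J e A ps Xs = (let k = length (wneg J A) in
     ball (wneg J A) Xs (uint J (\<lambda>n. lift k (e n)) A (map (lift k) ps) (bvars k)))"

lemma uint_IEx: "uint J e (IEx \<sigma> A) ps ns = TEx \<sigma> (uball J (up e) A (map (lift 1) ps) (map (lift 1) ns))"
  by (simp add: uball_def Let_def comp_def)

text \<open>The defining clauses cut witness tuples by \<open>take\<close> and \<open>drop\<close>.
  This form and \<open>uint_IAnd\<close> read them as appended pieces; with \<open>uint_IEx\<close>
  they stand in for those clauses, which leave the simpset below.\<close>

lemma uint_IImp:
  assumes "length fs = length (wpos J B)" "length as = length (wpos J A)"
  shows "uint J e (IImp A B) (fs @ gs) (as @ ds) =
    TImp (uball J e A as (map (\<lambda>g. apps g (as @ ds)) gs)) (uint J e B (map (\<lambda>f. apps f as) fs) ds)"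
  using assms by (simp add: uball_def Let_def)

lemma uint_IAnd:
  assumes "length ps = length (wpos J A)" "length ns = length (wneg J A)"
  shows "uint J e (IAnd A B) (ps @ qs) (ns @ ms) = TAnd (uint J e A ps ns) (uint J e B qs ms)"
  using assms by (simp add: Let_def)

lemma uball_no_witnesses: "wneg J A = [] \<Longrightarrow> uball J e A ps Xs = uint J e A ps []"
  by (simp add: uball_def Let_def bvars_def)

declare uint.simps(4,5,7) [simp del]

section \<open>Well-formedness and substitution for interpreted formulas\<close>

locale interpretation_setting =
  fixes S :: "('g, 'c, 'r) source"
    and T :: "('g, 'c, 'q) target"
    and J :: "('g, 'c, 'r, 'q) base"
  assumes extends_HA: "extends_HA S"
    and target_theory: "target_theory S T"
    and base_interpretation: "base_interpretation S T J"
    and bounding_at_Nat: "bounding_at_Nat J"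
begin

lemma NatT_S [simp]: "NatT \<in> types S"
  using extends_HA by (simp add: extends_HA_def)

lemma types_S_T: "\<tau> \<in> types S \<Longrightarrow> \<tau> \<in> types T"
  using target_theory by (auto simp: target_theory_def)

lemma constants_S_T: "c \<in> constants S \<Longrightarrow> c \<in> constants T"
  using target_theory by (auto simp: target_theory_def)

lemma wtypes_types: "\<tau> \<in> wtypes T \<Longrightarrow> \<tau> \<in> types T"
  using target_theory by (auto simp: target_theory_def)

lemma NatT_w [simp]: "NatT \<in> wtypes T"
  using target_theory by (simp add: target_theory_def)

lemma Fun_w [simp]: "\<rho> \<in> wtypes T \<Longrightarrow> \<tau> \<in> wtypes T \<Longrightarrow> Fun \<rho> \<tau> \<in> wtypes T"
  using target_theory by (simp add: target_theory_def)

lemma Fin_w [simp]: "\<rho> \<in> wtypes T \<Longrightarrow> Fin \<rho> \<in> wtypes T"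
  using target_theory by (simp add: target_theory_def)

lemma Fin_types: "\<rho> \<in> wtypes T \<Longrightarrow> Fin \<rho> \<in> types T"
  by (simp add: wtypes_types)

lemma arrows_w [simp]: "set \<sigma>s \<subseteq> wtypes T \<Longrightarrow> \<tau> \<in> wtypes T \<Longrightarrow> arrows \<sigma>s \<tau> \<in> wtypes T"
  by (induction \<sigma>s) simp_all

lemma closed_term: "\<tau> \<in> wtypes T \<Longrightarrow> \<exists>t. has_type T [] t \<tau>"
  using target_theory by (simp add: target_theory_def)

lemma
  assumes "\<rho> \<in> wtypes T" "\<tau> \<in> wtypes T"
  shows CK_T [simp]: "CK \<rho> \<tau> \<in> constants T"
    and CSing_T [simp]: "CSing \<rho> \<in> constants T"
  using assms target_theory by (simp_all add: target_theory_def)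

lemma CS_T [simp]:
  "\<rho> \<in> wtypes T \<Longrightarrow> \<sigma> \<in> wtypes T \<Longrightarrow> \<tau> \<in> wtypes T \<Longrightarrow> CS \<rho> \<sigma> \<tau> \<in> constants T"
  using target_theory by (simp add: target_theory_def)

lemma CMax_T [simp]: "CMax \<in> constants T"
  using target_theory by (simp add: target_theory_def)

lemma elementary: "A \<in> elementary_facts T \<Longrightarrow> prv T \<Gamma> H A"
  using target_theory by (auto simp: target_theory_def intro: prv_closed)

lemma has_type_S_T: "has_type S \<Gamma> t \<tau> \<Longrightarrow> has_type T \<Gamma> t \<tau>"
  by (induction t arbitrary: \<tau>) (auto intro: constants_S_T)

lemma has_type_monus:
  "has_type S \<Gamma> t NatT \<Longrightarrow> has_type S \<Gamma> u NatT \<Longrightarrow> has_type S \<Gamma> (monus t u) NatT"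
  and has_type_zero: "has_type S \<Gamma> zero NatT"
  using extends_HA by (auto simp: extends_HA_def monus_def pred_tm_def)

lemma has_type_monus_T:
  "has_type T \<Gamma> t NatT \<Longrightarrow> has_type T \<Gamma> u NatT \<Longrightarrow> has_type T \<Gamma> (monus t u) NatT"
  using extends_HA by (auto simp: extends_HA_def monus_def pred_tm_def intro!: constants_S_T)

lemma wf_tle: "has_type T \<Gamma> t NatT \<Longrightarrow> has_type T \<Gamma> u NatT \<Longrightarrow> wf_tfm T \<Gamma> (tle t u)"
  using has_type_monus_T has_type_S_T[OF has_type_zero, of \<Gamma>]
  by (auto intro: types_S_T)

text \<open>Both polarities are treated in one induction, since each witness tuple of an implication
  draws on positive and negative witnesses of its parts.\<close>

lemma witnesses_w:
  "wf_ifm S \<Gamma> A \<Longrightarrow> set (wpos J A) \<subseteq> wtypes T \<and> set (wneg J A) \<subseteq> wtypes T"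
proof (induction A arbitrary: \<Gamma>)
  case (IRel p ts)
  then show ?case using base_interpretation by (auto simp: base_interpretation_def)
next
  case (IAnd A B)
  show ?case using IAnd.IH[of \<Gamma>] IAnd.prems by simp
next
  case (IImp A B)
  have "set (wpos J A @ wneg J B) \<subseteq> wtypes T" "set (wpos J B) \<subseteq> wtypes T"
    "set (wneg J A) \<subseteq> wtypes T"
    using IImp.IH[of \<Gamma>] IImp.prems by simp_all
  then show ?case by (auto simp: subset_iff intro!: arrows_w)
next
  case (IAll \<sigma> A)
  show ?case using IAll.IH[of "\<sigma> # \<Gamma>"] IAll.prems by simp
next
  case (IEx \<sigma> A)
  show ?case using IEx.IH[of "\<sigma> # \<Gamma>"] IEx.prems by auto
qed auto

lemmas wpos_w = witnesses_w[THEN conjunct1] and wneg_w = witnesses_w[THEN conjunct2]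

lemma brel_wf:
  "wf_ifm S \<Gamma> (IRel p ts) \<Longrightarrow> wf_tfm T (isym_args p @ bpos J p @ bneg J p) (brel J p)"
  using base_interpretation by (auto simp: base_interpretation_def)

lemma wf_witness_ball:
  assumes "set \<tau>s \<subseteq> wtypes T" "list_all2 (has_type T \<Delta>) Xs (map Fin \<tau>s)" "wf_tfm T (\<tau>s @ \<Delta>) A"
  shows "wf_tfm T \<Delta> (ball \<tau>s Xs A)"
  using assms by (intro wf_ball) (auto intro: wtypes_types Fin_types)

text \<open>Supplies the well-formedness side conditions of the rules \<open>impI\<close>,
  \<open>exI\<close> and \<open>exE\<close>.\<close>

lemma wf_uint:
  assumes "wf_ifm S \<Gamma> A" "env_typed T \<Delta> e \<Gamma>"
    and "list_all2 (has_type T \<Delta>) ps (wpos J A)" "list_all2 (has_type T \<Delta>) ns (wneg J A)"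
  shows "wf_tfm T \<Delta> (uint J e A ps ns)"
  using assms
proof (induction A arbitrary: \<Gamma> \<Delta> e ps ns)
  case (IEq \<sigma> t u)
  then show ?case by (auto intro: types_S_T has_type_tsub has_type_S_T)
next
  case (IRel p ts)
  have "list_all2 (has_type T \<Delta>) (map (tsub e) ts) (isym_args p)"
    using IRel.prems(1)
    by (intro has_type_tsub_map[OF _ IRel.prems(2)]) (auto elim!: list_all2_mono intro: has_type_S_T)
  then have "list_all2 (has_type T \<Delta>) (map (tsub e) ts @ ps @ ns) (isym_args p @ bpos J p @ bneg J p)"
    using IRel.prems by (intro list_all2_appendI) auto
  then show ?case using brel_wf[OF IRel.prems(1)]
    by (auto intro: wf_tfm_sub env_typed_inst)
next
  case (IAnd A B)
  then show ?case by (auto simp: list_all2_append2 uint_IAnd)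
next
  case (IImp A B)
  from IImp.prems obtain fs gs as ds where eqs: "ps = fs @ gs" "ns = as @ ds"
    and fs: "list_all2 (has_type T \<Delta>) fs (map (arrows (wpos J A)) (wpos J B))"
    and gs: "list_all2 (has_type T \<Delta>) gs
      (map (\<lambda>\<tau>. arrows (wpos J A @ wneg J B) (Fin \<tau>)) (wneg J A))"
    and as: "list_all2 (has_type T \<Delta>) as (wpos J A)"
    and ds: "list_all2 (has_type T \<Delta>) ds (wneg J B)"
    by (auto simp: list_all2_append2)
  have "list_all2 (has_type T \<Delta>) (map (\<lambda>g. apps g (as @ ds)) gs) (map Fin (wneg J A))"
    using gs has_type_map_apps[OF list_all2_appendI[OF as ds], of gs "map Fin (wneg J A)"]
    by (simp add: comp_def)
  moreover have "list_all2 (has_type T \<Delta>) (map (\<lambda>f. apps f as) fs) (wpos J B)"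
    using as fs by (rule has_type_map_apps)
  moreover have "length fs = length (wpos J B)" "length as = length (wpos J A)"
    using fs as by (auto dest: list_all2_lengthD)
  ultimately show ?case
    using IImp as ds wneg_w[of \<Gamma> A]
    by (auto simp: eqs uint_IImp uball_def Let_def
        intro!: wf_witness_ball IImp.IH env_typed_lift has_type_lift_map has_type_bvars)
next
  case (IAll \<sigma> A)
  then show ?case
    by (auto intro!: types_S_T IAll.IH[of "\<sigma> # \<Gamma>"] env_typed_up has_type_lift1_map)
next
  case (IEx \<sigma> A)
  have "list_all2 (has_type T (\<sigma> # \<Delta>)) (map (lift 1) ns) (map Fin (wneg J A))"
    using has_type_lift1_map[OF IEx.prems(4)] by simp
  moreover have "list_all2 (has_type T (\<sigma> # \<Delta>)) (map (lift 1) ps) (wpos J A)"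
    using has_type_lift1_map[OF IEx.prems(3)] by simp
  ultimately show ?case
    using IEx.prems wneg_w[of "\<sigma> # \<Gamma>" A]
    by (auto simp del: map_map simp: uint_IEx uball_def Let_def
        intro!: types_S_T wf_witness_ball IEx.IH[of "\<sigma> # \<Gamma>"] env_typed_lift env_typed_up
          has_type_lift_map has_type_bvars)
qed simp

lemma wf_uball:
  assumes "wf_ifm S \<Gamma> A" "env_typed T \<Delta> e \<Gamma>"
    and "list_all2 (has_type T \<Delta>) ps (wpos J A)" "list_all2 (has_type T \<Delta>) Xs (map Fin (wneg J A))"
  shows "wf_tfm T \<Delta> (uball J e A ps Xs)"
  unfolding uball_def Let_def using assms wneg_w[OF assms(1)]
  by (auto intro!: wf_witness_ball wf_uint env_typed_lift has_type_lift_map has_type_bvars)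

text \<open>At an atom, \<open>brel J p\<close> has no variables besides its arguments and
  witnesses, so a substitution acts only on the terms put in for these. The length conditions ensure
  that \<open>inst\<close> covers this whole context.\<close>

lemma sub_uint:
  assumes "wf_ifm S \<Gamma> A" "length ps = length (wpos J A)" "length ns = length (wneg J A)"
  shows "sub s (uint J e A ps ns) =
    uint J (\<lambda>n. tsub s (e n)) A (map (tsub s) ps) (map (tsub s) ns)"
  using assms
proof (induction A arbitrary: \<Gamma> e s ps ns)
  case (IRel p ts)
  have "length ts = length (isym_args p)" using IRel.prems(1) by (auto dest: list_all2_lengthD)
  with IRel.prems have "length (map (tsub e) ts @ ps @ ns) = length (isym_args p @ bpos J p @ bneg J p)"
    by simp
  then have "tsub s (inst (map (tsub e) ts @ ps @ ns) n) =
      inst (map (tsub s) (map (tsub e) ts @ ps @ ns)) n"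
    if "n < length (isym_args p @ bpos J p @ bneg J p)" for n
    using that by (simp only: inst_def length_map if_True nth_map)
  from sub_cong[OF brel_wf[OF IRel.prems(1)] this] show ?case by (simp add: comp_def)
next
  case (IAnd A B)
  then show ?case
    using IAnd.IH[of \<Gamma>] by (simp add: uint.simps Let_def take_map drop_map)
next
  case (IImp A B)
  then show ?case
    using IImp.IH[of \<Gamma>]
    by (simp add: uint.simps Let_def take_map drop_map sub_ball comp_def flip: map_append)
next
  case (IAll \<sigma> A)
  then show ?case using IAll.IH[of "\<sigma> # \<Gamma>"] by (simp add: comp_def)
next
  case (IEx \<sigma> A)
  have *: "tsub (ups k r) (lift (Suc k) t) = lift k (tsub r (lift 1 t))" for k r and t :: "('g, 'c) tm"
    using tsub_ups_lift[of k r "lift 1 t"] by simp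
  show ?case using IEx.prems IEx.IH[of "\<sigma> # \<Gamma>"]
    by (simp add: uint.simps Let_def sub_ball comp_def *)
qed (simp_all add: comp_def)

lemma sub_uball:
  assumes "wf_ifm S \<Gamma> A" "length ps = length (wpos J A)" "length Xs = length (wneg J A)"
  shows "sub s (uball J e A ps Xs) =
    uball J (\<lambda>n. tsub s (e n)) A (map (tsub s) ps) (map (tsub s) Xs)"
  using assms by (simp add: uball_def Let_def sub_ball sub_uint[OF assms(1)] comp_def)

section \<open>Derived rules for interpreted quantifiers\<close>

lemma prv_uballE:
  assumes "prv T \<Delta> H (uball J e A ps Xs)" and "wf_ifm S \<Gamma> A" "length ps = length (wpos J A)"
    and "list_all2 (has_type T \<Delta>) ts (wneg J A)"
    and "\<And>i. i < length (wneg J A) \<Longrightarrow> prv T \<Delta> H (TMem (wneg J A ! i) (ts ! i) (Xs ! i))"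
  shows "prv T \<Delta> H (uint J e A ps ts)"
  using prv_ballE[OF assms(1)[unfolded uball_def Let_def] assms(4,5)] assms(2,3)
    list_all2_lengthD[OF assms(4)]
  by (simp add: sub_uint comp_def)

lemma prv_uballI:
  assumes "wf_ifm S \<Gamma> A" "list_all2 (has_type T \<Delta>) Xs (map Fin (wneg J A))"
    and "k = length (wneg J A)"
    and "prv T (wneg J A @ \<Delta>) (ball_hyps (wneg J A) Xs @ map (sub (\<lambda>n. Var (n + k))) H)
      (uint J (\<lambda>n. lift k (e n)) A (map (lift k) ps) (bvars k))"
  shows "prv T \<Delta> H (uball J e A ps Xs)"
  unfolding uball_def Let_def using assms wneg_w[OF assms(1)]
  by (intro prv_ballI) (auto intro: wtypes_types Fin_types)

lemma prv_uint_allE: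
  assumes "prv T \<Delta> H (uint J e (IAll \<sigma> A) ps ns)" and "has_type T \<Delta> t \<sigma>"
    and "wf_ifm S \<Gamma> A" "length ps = length (wpos J A)" "length ns = length (wneg J A)"
  shows "prv T \<Delta> H (uint J (t ## e) A ps ns)"
  using prv.allE[OF assms(1)[unfolded uint.simps] assms(2)] assms(3-)
  by (simp add: sub_uint comp_def)

subsection \<open>Closed terms for projections\<close>

lemma prv_K:
  assumes "has_type T \<Gamma> t \<sigma>" "has_type T \<Gamma> u \<tau>" "\<sigma> \<in> wtypes T" "\<tau> \<in> wtypes T"
  shows "prv T \<Gamma> H (TEq \<sigma> (Cst (CK \<sigma> \<tau>) \<cdot> t \<cdot> u) t)"
proof -
  \<comment> \<open>\<open>talls\<close> lists the innermost quantifier first, so types and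
    instances appear in the reverse of the order in the axiom; likewise for the other facts
    below.\<close>
  have "prv T \<Gamma> H (talls [\<tau>, \<sigma>] (TEq \<sigma> (Cst (CK \<sigma> \<tau>) \<cdot> Var 1 \<cdot> Var 0) (Var 1)))"
    using assms by (auto intro!: elementary elementary_facts.K[simplified])
  from prv_tallsE[OF this, of "[u, t]"] assms show ?thesis by (simp add: inst_def)
qed

lemma prv_S:
  assumes "has_type T \<Gamma> t (Fun \<rho> (Fun \<sigma> \<tau>))" "has_type T \<Gamma> u (Fun \<rho> \<sigma>)" "has_type T \<Gamma> v \<rho>"
    and "\<rho> \<in> wtypes T" "\<sigma> \<in> wtypes T" "\<tau> \<in> wtypes T"
  shows "prv T \<Gamma> H (TEq \<tau> (Cst (CS \<rho> \<sigma> \<tau>) \<cdot> t \<cdot> u \<cdot> v) (t \<cdot> v \<cdot> (u \<cdot> v)))"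
proof -
  have "prv T \<Gamma> H (talls [\<rho>, Fun \<rho> \<sigma>, Fun \<rho> (Fun \<sigma> \<tau>)]
    (TEq \<tau> (Cst (CS \<rho> \<sigma> \<tau>) \<cdot> Var 2 \<cdot> Var 1 \<cdot> Var 0) (Var 2 \<cdot> Var 0 \<cdot> (Var 1 \<cdot> Var 0))))"
    using assms by (auto intro!: elementary elementary_facts.S[simplified])
  from prv_tallsE[OF this, of "[v, u, t]"] assms show ?thesis by (simp add: inst_def)
qed

text \<open>In place of an abstraction, h is S (K f) g: applied to t it equals K f t (g t), hence f
  (g t).\<close>

lemma composition_term:
  assumes "has_type T [] f (Fun \<sigma> \<tau>)" "has_type T [] g (Fun \<rho> \<sigma>)"
    and "\<rho> \<in> wtypes T" "\<sigma> \<in> wtypes T" "\<tau> \<in> wtypes T"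
  obtains h where "has_type T [] h (Fun \<rho> \<tau>)"
    and "\<And>\<Gamma> H t. has_type T \<Gamma> t \<rho> \<Longrightarrow> prv T \<Gamma> H (TEq \<tau> (h \<cdot> t) (f \<cdot> (g \<cdot> t)))"
proof
  let ?c = "Cst (CK (Fun \<sigma> \<tau>) \<rho>) \<cdot> f"
  have c: "has_type T [] ?c (Fun \<rho> (Fun \<sigma> \<tau>))" using assms by auto
  then show "has_type T [] (Cst (CS \<rho> \<sigma> \<tau>) \<cdot> ?c \<cdot> g) (Fun \<rho> \<tau>)"
    using assms by auto
  fix \<Gamma> H t assume t: "has_type T \<Gamma> t \<rho>"
  have f: "has_type T \<Gamma> f (Fun \<sigma> \<tau>)" and g: "has_type T \<Gamma> g (Fun \<rho> \<sigma>)"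
    and c': "has_type T \<Gamma> ?c (Fun \<rho> (Fun \<sigma> \<tau>))"
    using assms c by (blast intro: has_type_closed)+
  have "prv T \<Gamma> H (TEq \<tau> (Cst (CS \<rho> \<sigma> \<tau>) \<cdot> ?c \<cdot> g \<cdot> t) (?c \<cdot> t \<cdot> (g \<cdot> t)))"
    using c' g t assms by (intro prv_S)
  moreover have "prv T \<Gamma> H (TEq (Fun \<sigma> \<tau>) (?c \<cdot> t) f)"
    using f t assms by (intro prv_K) auto
  then have "prv T \<Gamma> H (TEq \<tau> (?c \<cdot> t \<cdot> (g \<cdot> t)) (f \<cdot> (g \<cdot> t)))"
    using assms t g c' by (intro prv_eq_app) (auto intro: wtypes_types)
  moreover have "has_type T \<Gamma> (Cst (CS \<rho> \<sigma> \<tau>) \<cdot> ?c \<cdot> g \<cdot> t) \<tau>"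
    using c' g t assms by auto
  ultimately show "prv T \<Gamma> H (TEq \<tau> (Cst (CS \<rho> \<sigma> \<tau>) \<cdot> ?c \<cdot> g \<cdot> t) (f \<cdot> (g \<cdot> t)))"
    by (rule prv_eq_trans[OF _ _ wtypes_types[OF assms(5)]])
qed

lemma prv_eq_apps:
  assumes "list_all2 (has_type T \<Gamma>) ts \<sigma>s" and "prv T \<Gamma> H (TEq (arrows \<sigma>s \<tau>) t u)"
    and "has_type T \<Gamma> t (arrows \<sigma>s \<tau>)" and "set \<sigma>s \<subseteq> wtypes T" "\<tau> \<in> wtypes T"
  shows "prv T \<Gamma> H (TEq \<tau> (apps t ts) (apps u ts))"
  using assms
proof (induction ts \<sigma>s arbitrary: t u rule: list_all2_induct)
  case (Cons a ts \<sigma> \<sigma>s)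
  from Cons have "prv T \<Gamma> H (TEq (arrows \<sigma>s \<tau>) (t \<cdot> a) (u \<cdot> a))"
    by (intro prv_eq_app) (auto intro: wtypes_types)
  moreover have "has_type T \<Gamma> (t \<cdot> a) (arrows \<sigma>s \<tau>)" using Cons by auto
  ultimately show ?case using Cons by simp
qed simp

text \<open>Each induction step puts one dummy directly after t, by composing K with the f obtained
  so far: K discards the dummy before f t meets the remaining ones.\<close>

lemma dummy_arguments_term:
  assumes "has_type T [] h (Fun \<rho> \<tau>)" "set \<sigma>s \<subseteq> wtypes T" "\<rho> \<in> wtypes T" "\<tau> \<in> wtypes T"
  shows "\<exists>f. has_type T [] f (Fun \<rho> (arrows \<sigma>s \<tau>)) \<and>
    (\<forall>\<Gamma> H t ts. has_type T \<Gamma> t \<rho> \<longrightarrow> list_all2 (has_type T \<Gamma>) ts \<sigma>s \<longrightarrow>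
      prv T \<Gamma> H (TEq \<tau> (apps f (t # ts)) (h \<cdot> t)))"
  using assms(2)
proof (induction \<sigma>s)
  case Nil
  have "prv T \<Gamma> H (TEq \<tau> (h \<cdot> t) (h \<cdot> t))" if "has_type T \<Gamma> t \<rho>" for \<Gamma> H t
    using that assms has_type_closed[OF assms(1), of \<Gamma>]
    by (intro prv.eqI) (auto intro: wtypes_types)
  then show ?case using assms(1) by (intro HOL.exI[of _ h]) auto
next
  case (Cons \<sigma> \<sigma>s)
  then obtain f where f: "has_type T [] f (Fun \<rho> (arrows \<sigma>s \<tau>))"
    and feq: "\<And>\<Gamma> H t ts. has_type T \<Gamma> t \<rho> \<Longrightarrow> list_all2 (has_type T \<Gamma>) ts \<sigma>s \<Longrightarrow>
      prv T \<Gamma> H (TEq \<tau> (apps f (t # ts)) (h \<cdot> t))"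
    by auto
  let ?\<tau> = "arrows \<sigma>s \<tau>" and ?k = "Cst (CK (arrows \<sigma>s \<tau>) \<sigma>)"
  have w: "\<sigma> \<in> wtypes T" "?\<tau> \<in> wtypes T" "set \<sigma>s \<subseteq> wtypes T" using Cons.prems assms by auto
  have k: "has_type T \<Gamma> ?k (Fun ?\<tau> (Fun \<sigma> ?\<tau>))" for \<Gamma> using w by simp
  obtain g where g: "has_type T [] g (Fun \<rho> (Fun \<sigma> ?\<tau>))"
    and geq: "\<And>\<Gamma> H t. has_type T \<Gamma> t \<rho> \<Longrightarrow>
      prv T \<Gamma> H (TEq (Fun \<sigma> ?\<tau>) (g \<cdot> t) (?k \<cdot> (f \<cdot> t)))"
    using composition_term[OF k f] w assms by auto
  have "prv T \<Gamma> H (TEq \<tau> (apps g (t # a # ts)) (h \<cdot> t))"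
    if t: "has_type T \<Gamma> t \<rho>" and a: "has_type T \<Gamma> a \<sigma>" and ts: "list_all2 (has_type T \<Gamma>) ts \<sigma>s"
    for \<Gamma> H t a ts
  proof -
    have f': "has_type T \<Gamma> (f \<cdot> t) ?\<tau>" and g': "has_type T \<Gamma> (g \<cdot> t) (Fun \<sigma> ?\<tau>)"
      using has_type_closed[OF f, of \<Gamma>] has_type_closed[OF g, of \<Gamma>] t by auto
    then have ga: "has_type T \<Gamma> (g \<cdot> t \<cdot> a) ?\<tau>" using a by auto
    have "prv T \<Gamma> H (TEq ?\<tau> (g \<cdot> t \<cdot> a) (?k \<cdot> (f \<cdot> t) \<cdot> a))"
      using geq[OF t] g' a w by (intro prv_eq_app) (auto intro: wtypes_types)
    moreover have "prv T \<Gamma> H (TEq ?\<tau> (?k \<cdot> (f \<cdot> t) \<cdot> a) (f \<cdot> t))"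
      using f' a w by (intro prv_K)
    ultimately have "prv T \<Gamma> H (TEq ?\<tau> (g \<cdot> t \<cdot> a) (f \<cdot> t))"
      using wtypes_types[OF w(2)] ga by (rule prv_eq_trans)
    then have "prv T \<Gamma> H (TEq \<tau> (apps (g \<cdot> t \<cdot> a) ts) (apps (f \<cdot> t) ts))"
      using ts ga w assms by (intro prv_eq_apps)
    from prv_eq_trans[OF this _ wtypes_types[OF assms(4)] has_type_apps[OF ts ga]]
    show ?thesis using feq[OF t ts] by simp
  qed
  then show ?case using g by (intro HOL.exI[of _ g]) (auto simp: list_all2_Cons2)
qed

text \<open>Arguments behind position i are absorbed by \<open>dummy_arguments_term\<close>, those
  before it by one K for each induction step.\<close>

lemma projection_term:
  assumes "has_type T [] h (Fun (\<sigma>s ! i) \<tau>)" "i < length \<sigma>s" "set \<sigma>s \<subseteq> wtypes T" "\<tau> \<in> wtypes T"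
  shows "\<exists>f. has_type T [] f (arrows \<sigma>s \<tau>) \<and>
    (\<forall>\<Gamma> H ts. list_all2 (has_type T \<Gamma>) ts \<sigma>s \<longrightarrow> prv T \<Gamma> H (TEq \<tau> (apps f ts) (h \<cdot> (ts ! i))))"
  using assms(1-3)
proof (induction \<sigma>s arbitrary: i)
  case (Cons \<sigma> \<sigma>s)
  show ?case
  proof (cases i)
    case 0
    then obtain f where "has_type T [] f (Fun \<sigma> (arrows \<sigma>s \<tau>))"
      and "\<And>\<Gamma> H t ts. has_type T \<Gamma> t \<sigma> \<Longrightarrow> list_all2 (has_type T \<Gamma>) ts \<sigma>s \<Longrightarrow>
        prv T \<Gamma> H (TEq \<tau> (apps f (t # ts)) (h \<cdot> t))"
      using Cons.prems assms(4) dummy_arguments_term[of h \<sigma> \<tau> \<sigma>s] by auto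
    then show ?thesis using 0 by (intro HOL.exI[of _ f]) (auto simp: list_all2_Cons2)
  next
    case (Suc j)
    with Cons.prems Cons.IH[of j] obtain f where f: "has_type T [] f (arrows \<sigma>s \<tau>)"
      and feq: "\<And>\<Gamma> H ts. list_all2 (has_type T \<Gamma>) ts \<sigma>s \<Longrightarrow>
        prv T \<Gamma> H (TEq \<tau> (apps f ts) (h \<cdot> (ts ! j)))"
      by auto
    let ?\<tau> = "arrows \<sigma>s \<tau>" and ?g = "Cst (CK (arrows \<sigma>s \<tau>) \<sigma>) \<cdot> f"
    have w: "\<sigma> \<in> wtypes T" "?\<tau> \<in> wtypes T" "set \<sigma>s \<subseteq> wtypes T" using Cons.prems assms(4) by auto
    have "prv T \<Gamma> H (TEq \<tau> (apps ?g (a # ts)) (h \<cdot> (ts ! j)))"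
      if a: "has_type T \<Gamma> a \<sigma>" and ts: "list_all2 (has_type T \<Gamma>) ts \<sigma>s" for \<Gamma> H a ts
    proof -
      have ga: "has_type T \<Gamma> (?g \<cdot> a) ?\<tau>" using has_type_closed[OF f, of \<Gamma>] a w by auto
      have "prv T \<Gamma> H (TEq ?\<tau> (?g \<cdot> a) f)"
        using has_type_closed[OF f, of \<Gamma>] a w by (intro prv_K)
      then have "prv T \<Gamma> H (TEq \<tau> (apps (?g \<cdot> a) ts) (apps f ts))"
        using ts ga w assms(4) by (intro prv_eq_apps)
      from prv_eq_trans[OF this feq[OF ts] wtypes_types[OF assms(4)] has_type_apps[OF ts ga]]
      show ?thesis by simp
    qed
    moreover have "has_type T [] ?g (arrows (\<sigma> # \<sigma>s) \<tau>)" using f w by auto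
    ultimately show ?thesis using Suc by (intro HOL.exI[of _ ?g]) (auto simp: list_all2_Cons2)
  qed
qed simp

lemma prv_mem_sing:
  assumes "has_type T \<Gamma> t \<tau>" "\<tau> \<in> wtypes T"
  shows "prv T \<Gamma> H (TMem \<tau> t (Cst (CSing \<tau>) \<cdot> t))"
proof -
  have "prv T \<Gamma> H (talls [\<tau>, \<tau>]
      (tiff (TMem \<tau> (Var 0) (Cst (CSing \<tau>) \<cdot> Var 1)) (TEq \<tau> (Var 0) (Var 1))))"
    using assms by (auto intro!: elementary elementary_facts.mem_sing[simplified])
  from prv_tallsE[OF this, of "[t, t]"] assms
  have "prv T \<Gamma> H (tiff (TMem \<tau> t (Cst (CSing \<tau>) \<cdot> t)) (TEq \<tau> t t))" by (simp add: inst_def)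
  from prv.impE[OF prv.andE2[OF this] prv.eqI[OF wtypes_types[OF assms(2)] assms(1)]]
  show ?thesis .
qed

text \<open>The term g is singleton composed with maximum. It supplies the finite set of values at
  which the bound of k in the premise is taken.\<close>

lemma singleton_max_term:
  obtains g where "has_type T [] g (Fun (Fin NatT) (Fin NatT))"
    and "\<And>\<Gamma> H X. has_type T \<Gamma> X (Fin NatT) \<Longrightarrow> prv T \<Gamma> H (TMem NatT (Cst CMax \<cdot> X) (g \<cdot> X))"
proof -
  obtain g where g: "has_type T [] g (Fun (Fin NatT) (Fin NatT))"
    and geq: "\<And>\<Gamma> H X. has_type T \<Gamma> X (Fin NatT) \<Longrightarrow>
      prv T \<Gamma> H (TEq (Fin NatT) (g \<cdot> X) (Cst (CSing NatT) \<cdot> (Cst CMax \<cdot> X)))"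
    using composition_term[of "Cst (CSing NatT)" NatT "Fin NatT" "Cst CMax" "Fin NatT"] by auto
  have types: "NatT \<in> types T" "Fin NatT \<in> types T" by (simp_all add: wtypes_types)
  have "prv T \<Gamma> H (TMem NatT (Cst CMax \<cdot> X) (g \<cdot> X))" if X: "has_type T \<Gamma> X (Fin NatT)" for \<Gamma> H X
  proof -
    have m: "has_type T \<Gamma> (Cst CMax \<cdot> X) NatT" and gX: "has_type T \<Gamma> (g \<cdot> X) (Fin NatT)"
      using has_type_closed[OF g] X by auto
    from prv_mem_eq[OF prv_eq_sym[OF geq[OF X] types(2) gX] prv_mem_sing[OF m] types m]
    show ?thesis by simp
  qed
  with g show ?thesis by (rule that)
qed

text \<open>Here h is a function on terms, so that the member may be the projected argument itself
  or its maximum. Membership is carried over along the provable equality of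
  \<open>projection_term\<close>.\<close>

lemma member_projection_term:
  assumes g: "has_type T [] g (Fun (\<sigma>s ! i) (Fin \<tau>))" and i: "i < length \<sigma>s"
    and w: "set \<sigma>s \<subseteq> wtypes T" "\<tau> \<in> wtypes T"
    and typed: "\<And>\<Gamma> t. has_type T \<Gamma> t (\<sigma>s ! i) \<Longrightarrow> has_type T \<Gamma> (h t) \<tau>"
    and mem: "\<And>\<Gamma> H t. has_type T \<Gamma> t (\<sigma>s ! i) \<Longrightarrow> prv T \<Gamma> H (TMem \<tau> (h t) (g \<cdot> t))"
  shows "\<exists>f. has_type T [] f (arrows \<sigma>s (Fin \<tau>)) \<and>
    (\<forall>\<Gamma> H ts. list_all2 (has_type T \<Gamma>) ts \<sigma>s \<longrightarrow> prv T \<Gamma> H (TMem \<tau> (h (ts ! i)) (apps f ts)))"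
proof -
  obtain f where f: "has_type T [] f (arrows \<sigma>s (Fin \<tau>))"
    and feq: "\<And>\<Gamma> H ts. list_all2 (has_type T \<Gamma>) ts \<sigma>s \<Longrightarrow>
      prv T \<Gamma> H (TEq (Fin \<tau>) (apps f ts) (g \<cdot> (ts ! i)))"
    using projection_term[OF g i w(1)] w(2) by auto
  have "prv T \<Gamma> H (TMem \<tau> (h (ts ! i)) (apps f ts))" if ts: "list_all2 (has_type T \<Gamma>) ts \<sigma>s" for \<Gamma> H ts
  proof -
    have ti: "has_type T \<Gamma> (ts ! i) (\<sigma>s ! i)" using ts i by (simp add: list_all2_conv_all_nth)
    have "prv T \<Gamma> H (TEq (Fin \<tau>) (g \<cdot> (ts ! i)) (apps f ts))"
      using feq[OF ts] Fin_types[OF w(2)] has_type_apps[OF ts has_type_closed[OF f]]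
      by (rule prv_eq_sym)
    then show ?thesis
      using mem[OF ti] wtypes_types[OF w(2)] Fin_types[OF w(2)] typed[OF ti] by (rule prv_mem_eq)
  qed
  then show ?thesis using f by blast
qed

subsection \<open>Interpretability of closures\<close>

lemma wf_guard:
  assumes "\<And>A. A \<in> set Is \<Longrightarrow> wf_ifm S \<Gamma> A" "Is \<noteq> []"
  obtains G where "wf_ifm S \<Gamma> G" "\<And>A. guard Is A = IImp G A"
proof -
  obtain P Ps where Is: "Is = P # Ps" using assms(2) by (cases Is) auto
  have "wf_ifm S \<Gamma> P" "\<forall>A \<in> set Ps. wf_ifm S \<Gamma> A" using assms(1) Is by auto
  then have "wf_ifm S \<Gamma> (foldl IAnd P Ps)" by (induction Ps arbitrary: P) auto
  then show ?thesis using Is that by simp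
qed

text \<open>The negative witnesses are quantified outside the variables of \<open>\<Gamma>\<close>,
  hence the context \<open>\<Gamma> @ wneg J A\<close>. The concrete index shifts are replaced by an
  arbitrary typed environment, so that later arguments need not know them.\<close>

lemma U_interpretableI:
  assumes "set \<Gamma> \<subseteq> types S" "wf_ifm S \<Gamma> A"
    and "list_all2 (has_type T []) ts (wpos J A)"
    and "\<And>e ns. env_typed T (\<Gamma> @ wneg J A) e \<Gamma> \<Longrightarrow> list_all2 (has_type T (\<Gamma> @ wneg J A)) ns (wneg J A) \<Longrightarrow>
      prv T (\<Gamma> @ wneg J A) [] (uint J e A ts ns)"
  shows "U_interpretable T J [] (ialls \<Gamma> A)"
proof -
  let ?k = "length \<Gamma>" and ?n = "length (wneg J A)"
  have "map (lift ?k) ts = ts"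
    using assms(3) by (auto simp: list_all2_conv_all_nth intro!: nth_equalityI lift_closed)
  moreover have "prv T (\<Gamma> @ wneg J A) [] (uint J (ups ?k (\<lambda>n. Var (n + ?n))) A ts (map (lift ?k) (bvars ?n)))"
    using has_type_bvars[of T "wneg J A" "[]"]
    by (intro assms(4) has_type_lift_map) (auto simp: env_typed_def ups_def nth_append)
  moreover have \<Gamma>: "set \<Gamma> \<subseteq> types T" and w: "set (wneg J A) \<subseteq> types T"
    using assms(1) wneg_w[OF assms(2)] types_S_T wtypes_types by auto
  ultimately have "prv T (wneg J A) [] (uint J (\<lambda>n. Var (n + ?n)) (ialls \<Gamma> A) ts (bvars ?n))"
    using prv_tallsI[OF \<Gamma>, of "wneg J A" "[]"] by (simp add: uint_ialls)
  then have "prv T [] [] (talls (wneg J A) (uint J (\<lambda>n. Var (n + ?n)) (ialls \<Gamma> A) ts (bvars ?n)))"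
    using prv_tallsI[OF w, of "[]" "[]"] by simp
  then show ?thesis using assms(3) unfolding U_interpretable_def by auto
qed

text \<open>
  The negative witnesses of the guard are not needed: any closed terms of the right types realize them.
\<close>

lemma U_interpretable_input_closureI:
  fixes P :: "nat \<Rightarrow> 'g ty list \<Rightarrow> ('g, 'c) tm \<Rightarrow> ('g, 'c) tm list \<Rightarrow> bool"
  assumes \<Gamma>: "set \<Gamma> \<subseteq> types S" and wf: "wf_ifm S \<Gamma> A"
    and pos: "wpos J A = map (arrows (wneg J A)) \<theta>s"
    and ex: "\<And>\<pi>s i. set \<pi>s \<subseteq> wtypes T \<Longrightarrow> i < length \<theta>s \<Longrightarrow>
      \<exists>t. has_type T [] t (arrows (\<pi>s @ wneg J A) (\<theta>s ! i)) \<and>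
        (\<forall>\<Delta> ps ns. list_all2 (has_type T \<Delta>) ps \<pi>s \<longrightarrow> list_all2 (has_type T \<Delta>) ns (wneg J A) \<longrightarrow>
           P i \<Delta> (apps t ps) ns)"
    and realized: "\<And>\<Delta> e ts ns. env_typed T \<Delta> e \<Gamma> \<Longrightarrow> list_all2 (has_type T \<Delta>) ns (wneg J A) \<Longrightarrow>
      list_all2 (has_type T \<Delta>) ts (wpos J A) \<Longrightarrow>
      (\<And>i. i < length \<theta>s \<Longrightarrow> P i \<Delta> (ts ! i) ns) \<Longrightarrow> prv T \<Delta> [] (uint J e A ts ns)"
  shows "U_interpretable T J [] (input_closure \<Gamma> A)"
proof -
  \<comment> \<open>The types \<open>\<pi>s\<close> stand for extra leading arguments: none for an
    empty context, otherwise the positive witnesses of the guard.\<close>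
  have tuple: "\<exists>ts. list_all2 (has_type T []) ts (map (arrows \<pi>s) (wpos J A)) \<and>
      (\<forall>i < length \<theta>s. \<forall>\<Delta> ps ns. list_all2 (has_type T \<Delta>) ps \<pi>s \<longrightarrow>
        list_all2 (has_type T \<Delta>) ns (wneg J A) \<longrightarrow> P i \<Delta> (apps (ts ! i) ps) ns)"
    if "set \<pi>s \<subseteq> wtypes T" for \<pi>s
  proof -
    have "\<forall>i < length \<theta>s. \<exists>t. has_type T [] t (arrows (\<pi>s @ wneg J A) (\<theta>s ! i)) \<and>
        (\<forall>\<Delta> ps ns. list_all2 (has_type T \<Delta>) ps \<pi>s \<longrightarrow> list_all2 (has_type T \<Delta>) ns (wneg J A) \<longrightarrow>
           P i \<Delta> (apps t ps) ns)"
      using ex[OF that] by blast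
    then obtain ts where "length ts = length \<theta>s" and
      "\<And>i. i < length \<theta>s \<Longrightarrow> has_type T [] (ts ! i) (arrows (\<pi>s @ wneg J A) (\<theta>s ! i)) \<and>
        (\<forall>\<Delta> ps ns. list_all2 (has_type T \<Delta>) ps \<pi>s \<longrightarrow> list_all2 (has_type T \<Delta>) ns (wneg J A) \<longrightarrow>
           P i \<Delta> (apps (ts ! i) ps) ns)"
      unfolding Skolem_list_nth by blast
    then show ?thesis
      by (intro HOL.exI[of _ ts]) (auto simp: pos list_all2_conv_all_nth[of _ ts] arrows_append)
  qed
  let ?Is = "map (\<lambda>i. IInp (\<Gamma> ! i) (Var i)) [0..<length \<Gamma>] :: ('g, 'c, 'r) ifm list"
  show ?thesis
  \<comment> \<open>The guard is an implication only for a non-empty context, and this changes the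
    types of the realizers.\<close>
  proof (cases "\<Gamma> = []")
    case True
    obtain ts where "list_all2 (has_type T []) ts (wpos J A)"
      and "\<And>i \<Delta> ns. i < length \<theta>s \<Longrightarrow> list_all2 (has_type T \<Delta>) ns (wneg J A) \<Longrightarrow> P i \<Delta> (ts ! i) ns"
      using tuple[of "[]"] by (auto simp: map_idI)
    then have "U_interpretable T J [] (ialls \<Gamma> A)"
      using \<Gamma> wf by (intro U_interpretableI[of \<Gamma> A ts] realized)
        (auto intro: has_type_closed_map)
    then show ?thesis by (simp add: input_closure_def True)
  next
    case False
    have Is: "wf_ifm S \<Gamma> X" if "X \<in> set ?Is" for X
      using that \<Gamma> by (auto simp: subset_iff)
    have "?Is \<noteq> []" using False by simp
    from wf_guard[OF Is this] obtain G where G: "wf_ifm S \<Gamma> G" and guard: "guard ?Is A = IImp G A"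
      by blast
    have piw: "set (wpos J G) \<subseteq> wtypes T" using wpos_w[OF G] .
    obtain fs where fs: "list_all2 (has_type T []) fs (map (arrows (wpos J G)) (wpos J A))"
      and P: "\<And>i \<Delta> ps ns. i < length \<theta>s \<Longrightarrow> list_all2 (has_type T \<Delta>) ps (wpos J G) \<Longrightarrow>
        list_all2 (has_type T \<Delta>) ns (wneg J A) \<Longrightarrow> P i \<Delta> (apps (fs ! i) ps) ns"
      using tuple[OF piw] by auto
    have "\<forall>i < length (wneg J G). \<exists>t. has_type T [] t (arrows (wpos J G @ wneg J A) (Fin (wneg J G ! i)))"
      using piw wneg_w[OF wf] wneg_w[OF G] by (auto simp: subset_iff intro!: closed_term arrows_w Fin_w)
    then obtain gs where "length gs = length (wneg J G)" and
      "\<And>i. i < length (wneg J G) \<Longrightarrow>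
        has_type T [] (gs ! i) (arrows (wpos J G @ wneg J A) (Fin (wneg J G ! i)))"
      unfolding Skolem_list_nth by blast
    then have gs: "list_all2 (has_type T []) gs
        (map (\<lambda>\<tau>. arrows (wpos J G @ wneg J A) (Fin \<tau>)) (wneg J G))"
      by (simp add: list_all2_conv_all_nth)
    have "U_interpretable T J [] (ialls \<Gamma> (IImp G A))"
    proof (rule U_interpretableI[OF \<Gamma>])
      show "wf_ifm S \<Gamma> (IImp G A)" using G wf by simp
      show "list_all2 (has_type T []) (fs @ gs) (wpos J (IImp G A))"
        using fs gs by (auto intro: list_all2_appendI)
      fix e ns
      let ?\<Delta> = "\<Gamma> @ wneg J (IImp G A)"
      assume e: "env_typed T ?\<Delta> e \<Gamma>" and "list_all2 (has_type T ?\<Delta>) ns (wneg J (IImp G A))"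
      then obtain as ds where ns: "ns = as @ ds" and as: "list_all2 (has_type T ?\<Delta>) as (wpos J G)"
        and ds: "list_all2 (has_type T ?\<Delta>) ds (wneg J A)"
        by (auto simp: list_all2_append2)
      have "list_all2 (has_type T ?\<Delta>) (map (\<lambda>g. apps g (as @ ds)) gs) (map Fin (wneg J G))"
        using has_type_map_apps[OF list_all2_appendI[OF as ds], of gs "map Fin (wneg J G)"]
          has_type_closed_map[OF gs]
        by (simp add: comp_def)
      then have wfG: "wf_tfm T ?\<Delta> (uball J e G as (map (\<lambda>g. apps g (as @ ds)) gs))"
        using G e as by (intro wf_uball)
      have "prv T ?\<Delta> [] (uint J e A (map (\<lambda>f. apps f as) fs) ds)"
      proof (rule realized[OF e ds])
        show "list_all2 (has_type T ?\<Delta>) (map (\<lambda>f. apps f as) fs) (wpos J A)"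
          using as has_type_closed_map[OF fs] by (rule has_type_map_apps)
        have "length fs = length \<theta>s" using fs pos by (auto dest: list_all2_lengthD)
        then show "P i ?\<Delta> (map (\<lambda>f. apps f as) fs ! i) ds" if "i < length \<theta>s" for i
          using P[OF that as ds] that by simp
      qed
      \<comment> \<open>The consequent is provable outright once \<open>fs\<close> is applied to the
        witnesses of the guard, so the antecedent enters by weakening.\<close>
      then have "prv T ?\<Delta> [] (TImp (uball J e G as (map (\<lambda>g. apps g (as @ ds)) gs))
          (uint J e A (map (\<lambda>f. apps f as) fs) ds))"
        by (rule prv.impI[OF wfG prv_weaken]) simp
      moreover have "length fs = length (wpos J A)" "length as = length (wpos J G)"
        using fs as by (auto dest: list_all2_lengthD)
      ultimately show "prv T ?\<Delta> [] (uint J e (IImp G A) (fs @ gs) ns)"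
        by (simp add: ns uint_IImp)
    qed
    then show ?thesis unfolding input_closure_def guard .
  qed
qed

section \<open>The order on the natural numbers and the maximum of a finite set\<close>

lemma prv_le_refl: "has_type T \<Gamma> t NatT \<Longrightarrow> prv T \<Gamma> H (tle t t)"
proof -
  assume t: "has_type T \<Gamma> t NatT"
  have "prv T \<Gamma> H (talls [NatT] (tle (Var 0) (Var 0)))"
    by (auto intro!: elementary elementary_facts.le_refl)
  from prv_tallsE[OF this, of "[t]"] t show ?thesis by (simp add: inst_def)
qed

lemma prv_le_trans:
  assumes "prv T \<Gamma> H (tle t u)" "prv T \<Gamma> H (tle u v)"
    and "has_type T \<Gamma> t NatT" "has_type T \<Gamma> u NatT" "has_type T \<Gamma> v NatT"
  shows "prv T \<Gamma> H (tle t v)"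
proof -
  have "prv T \<Gamma> H (talls [NatT, NatT, NatT]
      (TImp (tle (Var 2) (Var 1)) (TImp (tle (Var 1) (Var 0)) (tle (Var 2) (Var 0)))))"
    by (auto intro!: elementary elementary_facts.le_trans[simplified])
  from prv_tallsE[OF this, of "[v, u, t]"] assms(3-)
  have "prv T \<Gamma> H (TImp (tle t u) (TImp (tle u v) (tle t v)))" by (simp add: inst_def)
  from prv.impE[OF prv.impE[OF this assms(1)] assms(2)] show ?thesis .
qed

lemma prv_le_max:
  assumes "prv T \<Gamma> H (TMem NatT t X)" "has_type T \<Gamma> t NatT" "has_type T \<Gamma> X (Fin NatT)"
  shows "prv T \<Gamma> H (tle t (Cst CMax \<cdot> X))"
proof -
  have "prv T \<Gamma> H (talls [NatT, Fin NatT]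
      (TImp (TMem NatT (Var 0) (Var 1)) (tle (Var 0) (Cst CMax \<cdot> Var 1))))"
    by (auto intro!: elementary elementary_facts.max_ge[simplified])
  from prv_tallsE[OF this, of "[t, X]"] assms(2,3)
  have "prv T \<Gamma> H (TImp (TMem NatT t X) (tle t (Cst CMax \<cdot> X)))" by (simp add: inst_def)
  from prv.impE[OF this assms(1)] show ?thesis .
qed

end


section \<open>The contra-collection principle\<close>

text \<open>A zipped form of \<open>ball_hyps\<close> for arbitrary terms in place of the bound
  variables; unlike the indexed form it splits along appended tuples, here those of B, of n and of
  C.\<close>

definition mem_fms ::
  "'g ty list \<Rightarrow> ('g, 'c) tm list \<Rightarrow> ('g, 'c) tm list \<Rightarrow> ('g, 'c, 'q) tfm list" where
  "mem_fms \<tau>s ts Xs = map (\<lambda>(\<tau>, t, X). TMem \<tau> t X) (zip \<tau>s (zip ts Xs))"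

lemma mem_fms_append [simp]:
  "length ts = length \<tau>s \<Longrightarrow> length Xs = length \<tau>s \<Longrightarrow>
    mem_fms (\<tau>s @ \<rho>s) (ts @ us) (Xs @ Ys) = mem_fms \<tau>s ts Xs @ mem_fms \<rho>s us Ys"
  by (simp add: mem_fms_def)

lemma mem_fms_Cons [simp]: "mem_fms (\<tau> # \<tau>s) (t # ts) (X # Xs) = TMem \<tau> t X # mem_fms \<tau>s ts Xs"
  by (simp add: mem_fms_def)

lemma sub_mem_fms: "map (sub s) (mem_fms \<tau>s ts Xs) = mem_fms \<tau>s (map (tsub s) ts) (map (tsub s) Xs)"
  by (auto simp: mem_fms_def zip_map1 zip_map2 case_prod_unfold)

lemma nth_mem_fms:
  "i < length \<tau>s \<Longrightarrow> length ts = length \<tau>s \<Longrightarrow> length Xs = length \<tau>s \<Longrightarrow>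
    TMem (\<tau>s ! i) (ts ! i) (Xs ! i) \<in> set (mem_fms \<tau>s ts Xs)"
  by (force simp: mem_fms_def in_set_conv_nth)

lemma uint_IAnd_no_positive:
  assumes "wpos J A = []" "length ns = length (wneg J A)"
  shows "uint J e (IAnd A B) [] (ns @ ms) = TAnd (uint J e A [] ns) (uint J e B [] ms)"
  using uint_IAnd[of "[]" J A ns e B "[]" ms] assms by simp

lemma uint_IImp_no_positive:
  assumes "wpos J B = []" "length as = length (wpos J A)"
  shows "uint J e (IImp A B) gs (as @ ds) =
    TImp (uball J e A as (map (\<lambda>g. apps g (as @ ds)) gs)) (uint J e B [] ds)"
  using uint_IImp[of "[]" J B as A e gs ds] assms by simp

lemma ball_hyps_eq:
  "length Xs = length \<tau>s \<Longrightarrow>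
    ball_hyps \<tau>s Xs = mem_fms \<tau>s (bvars (length \<tau>s)) (map (lift (length \<tau>s)) Xs)"
  by (auto simp: ball_hyps_def mem_fms_def bvars_def intro!: nth_equalityI)

locale contra_collection = interpretation_setting S T J
  for S :: "('g, 'c, 'r) source" and T :: "('g, 'c, 'q) target" and J :: "('g, 'c, 'r, 'q) base" +
  fixes \<sigma> :: "'g ty" and \<tau>s \<rho>s :: "'g ty list" and B C :: "('g, 'c, 'r) sfm"
  assumes \<sigma>_S: "\<sigma> \<in> types S" and \<tau>s_S: "set \<tau>s \<subseteq> types S" and \<rho>s_S: "set \<rho>s \<subseteq> types S"
    and wf_B: "wf_sfm S (\<sigma> # \<tau>s) B" and wf_C: "wf_sfm S (NatT # \<sigma> # \<tau>s @ \<rho>s) C"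
    and pos_B: "wpos J (relat B) = []" and pos_C: "wpos J (relat C) = []"
begin

declare pos_B [simp] pos_C [simp]

abbreviation "\<Gamma> \<equiv> \<tau>s @ \<rho>s"
abbreviation "\<beta>s \<equiv> wneg J (relat B)"
abbreviation "\<gamma>s \<equiv> wneg J (relat C)"

text \<open>The bounded quantifier leaves a witness-free equation where
  \<open>conclusion_matrix\<close> has I(n); this is why n contributes a witness there and not here.
  The context is x, k, y, z.\<close>

abbreviation premise_matrix :: "('g, 'c, 'r) ifm" where
  "premise_matrix \<equiv> IAnd (relat (ssub (skip 1) B))
     (IAll NatT (IImp (IEq NatT (monus (Var 0) (Var 2)) zero) (relat (ssub (skip 2) C))))"

abbreviation conclusion_matrix :: "('g, 'c, 'r) ifm" where
  "conclusion_matrix \<equiv> IAnd (relat B) (IAll NatT (IImp (IInp NatT (Var 0)) (relat C)))"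

abbreviation premise :: "('g, 'c, 'r) ifm" where
  "premise \<equiv> IAll NatT (IImp (IInp NatT (Var 0)) (IEx \<sigma> premise_matrix))"

abbreviation conclusion :: "('g, 'c, 'r) ifm" where
  "conclusion \<equiv> IEx \<sigma> conclusion_matrix"

lemma Inp_NatT [simp]: "bpos J (Inp NatT) = [NatT]" "bneg J (Inp NatT) = []"
  "brel J (Inp NatT) = tle (Var 0) (Var 1)"
  using bounding_at_Nat by (simp_all add: bounding_at_Nat_def)

lemma uball_Inp_NatT [simp]: "uball J e (IInp NatT t) [u] Xs = tle (tsub e t) u"
  by (simp add: uball_no_witnesses inst_def)

text \<open>The \<open>NatT\<close> of the premise is the bound of k, outside the existential
  quantifier and so not under \<open>Fin\<close>; that of the conclusion is the bound of n, inside
  it.\<close>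

lemma wpos_premise [simp]: "wpos J premise_matrix = []" "wpos J premise = []"
  and wneg_premise [simp]: "wneg J premise_matrix = \<beta>s @ \<gamma>s"
    "wneg J premise = NatT # map Fin (\<beta>s @ \<gamma>s)"
  and wpos_conclusion [simp]: "wpos J conclusion_matrix = []" "wpos J conclusion = []"
  and wneg_conclusion [simp]: "wneg J conclusion_matrix = \<beta>s @ NatT # \<gamma>s"
    "wneg J conclusion = map Fin (\<beta>s @ NatT # \<gamma>s)"
  by simp_all

lemma wf_relat_B: "wf_ifm S (\<sigma> # \<Gamma>) (relat B)"
proof -
  \<comment> \<open>The parameters z are appended at the end of the context of B, so weakening is
    the identity renaming.\<close>
  have "ssub Var A = A" for A :: "('g, 'c, 'r) sfm"
    by (induction A) (auto simp: map_idI)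
  moreover have "env_typed S (\<sigma> # \<Gamma>) Var (\<sigma> # \<tau>s)"
    by (auto simp: env_typed_def nth_append nth_Cons split: nat.split)
  ultimately show ?thesis using wf_sfm_ssub[OF wf_B] wf_relat by metis
qed

lemma wf_relat_C: "wf_ifm S (NatT # \<sigma> # \<Gamma>) (relat C)"
  using wf_C by (rule wf_relat)

lemma wf_premise_matrix: "wf_ifm S (\<sigma> # NatT # \<Gamma>) premise_matrix"
proof -
  have "env_typed S (\<sigma> # NatT # \<Gamma>) (skip 1) (\<sigma> # \<tau>s)"
    by (auto simp: env_typed_def skip_def nth_append nth_Cons split: nat.split)
  from wf_relat[OF wf_sfm_ssub[OF wf_B this]]
  have "wf_ifm S (\<sigma> # NatT # \<Gamma>) (relat (ssub (skip 1) B))" .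
  moreover have "env_typed S (NatT # \<sigma> # NatT # \<Gamma>) (skip 2) (NatT # \<sigma> # \<Gamma>)"
    by (auto simp: env_typed_def skip_def nth_Cons split: nat.split)
  from wf_relat[OF wf_sfm_ssub[OF wf_C this]]
  have "wf_ifm S (NatT # \<sigma> # NatT # \<Gamma>) (relat (ssub (skip 2) C))" .
  moreover have "has_type S (NatT # \<sigma> # NatT # \<Gamma>) (monus (Var 0) (Var 2)) NatT"
    by (rule has_type_monus) simp_all
  ultimately show ?thesis using has_type_zero by simp
qed

lemma wf_premise: "wf_ifm S \<Gamma> premise"
  using wf_premise_matrix \<sigma>_S by simp

lemma wf_conclusion_matrix: "wf_ifm S (\<sigma> # \<Gamma>) conclusion_matrix"
  using wf_relat_B wf_relat_C by simp

lemma wf_conclusion: "wf_ifm S \<Gamma> conclusion"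
  using wf_conclusion_matrix \<sigma>_S by simp

text \<open>In the context x, k, y, z of the matrix, \<open>e 1\<close> is the value of k; under the
  quantifier over n it moves to index 2. The renamings \<open>skip 1\<close> and
  \<open>skip 2\<close> pass over it, since neither B nor C mentions k.\<close>

lemma premise_matrixE:
  assumes "prv T \<Delta> H (uball J e premise_matrix [] (Xs @ Ys))"
    and "list_all2 (has_type T \<Delta>) bs \<beta>s" "list_all2 (has_type T \<Delta>) cs \<gamma>s"
    and "length Xs = length \<beta>s" "length Ys = length \<gamma>s"
    and "set (mem_fms \<beta>s bs Xs) \<subseteq> set H" "set (mem_fms \<gamma>s cs Ys) \<subseteq> set H"
  shows "prv T \<Delta> H (uint J (\<lambda>n. tsub e (skip 1 n)) (relat B) [] bs)" (is ?b)
    and "has_type T \<Delta> t NatT \<Longrightarrow> prv T \<Delta> H (tle t (e 1)) \<Longrightarrow>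
      prv T \<Delta> H (uint J (\<lambda>n. tsub (t ## e) (skip 2 n)) (relat C) [] cs)"
proof -
  have len: "length bs = length \<beta>s" "length cs = length \<gamma>s"
    using assms(2,3) by (auto dest: list_all2_lengthD)
  have "prv T \<Delta> H (TMem ((\<beta>s @ \<gamma>s) ! i) ((bs @ cs) ! i) ((Xs @ Ys) ! i))"
    if "i < length (\<beta>s @ \<gamma>s)" for i
    using nth_mem_fms[OF that, of "bs @ cs" "Xs @ Ys"] len assms(4-) by (auto intro: prv.hyp)
  with prv_uballE[OF assms(1) wf_premise_matrix, of "bs @ cs"] assms(2,3)
  have *: "prv T \<Delta> H (uint J e premise_matrix [] (bs @ cs))"
    by (simp add: list_all2_appendI)
  then have *: "prv T \<Delta> H (TAnd (uint J e (relat (ssub (skip 1) B)) [] bs) (uint J e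
      (IAll NatT (IImp (IEq NatT (monus (Var 0) (Var 2)) zero) (relat (ssub (skip 2) C)))) [] cs))"
    using len by (subst (asm) uint_IAnd_no_positive) simp_all
  from prv.andE1[OF this] show ?b by (simp add: uint_relat_ssub)
  show "prv T \<Delta> H (uint J (\<lambda>n. tsub (t ## e) (skip 2 n)) (relat C) [] cs)"
    if t: "has_type T \<Delta> t NatT" and le: "prv T \<Delta> H (tle t (e 1))"
  proof -
    have "prv T \<Delta> H (uint J (t ## e) (IImp (IEq NatT (monus (Var 0) (Var 2)) zero)
        (relat (ssub (skip 2) C))) [] ([] @ cs))"
      using prv_uint_allE[OF prv.andE2[OF *] t, of "NatT # \<sigma> # NatT # \<Gamma>"] wf_premise_matrix len
      by simp
    then have "prv T \<Delta> H (TImp (tle t (e 1)) (uint J (t ## e) (relat (ssub (skip 2) C)) [] cs))"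
      by (subst (asm) uint_IImp_no_positive) (simp_all add: uball_no_witnesses numeral_2_eq_2)
    from prv.impE[OF this le] show ?thesis by (simp add: uint_relat_ssub)
  qed
qed

text \<open>Both matrices are read at the same x, which is \<open>Var 0\<close> of the extended
  context; Y is the premise matrix with max N for k.\<close>

lemma conclusion_matrixI:
  assumes e: "env_typed T \<Delta> e \<Gamma>" and Xs: "list_all2 (has_type T \<Delta>) Xs (map Fin \<beta>s)"
    and N: "has_type T \<Delta> N (Fin NatT)" and Ys: "list_all2 (has_type T \<Delta>) Ys (map Fin \<gamma>s)"
  defines "Y \<equiv> uball J (up ((Cst CMax \<cdot> N) ## e)) premise_matrix [] (map (lift 1) (Xs @ Ys))"
  shows "prv T (\<sigma> # \<Delta>) (Y # H)
    (uball J (up e) conclusion_matrix [] (map (lift 1) (Xs @ N # Ys)))"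
proof -
  let ?\<nu>s = "\<beta>s @ NatT # \<gamma>s"
  let ?k = "length ?\<nu>s"
  let ?\<Delta> = "?\<nu>s @ \<sigma> # \<Delta>"
  let ?m = "Cst CMax \<cdot> N"
  have len: "length Xs = length \<beta>s" "length Ys = length \<gamma>s"
    using Xs Ys by (auto dest: list_all2_lengthD)
  \<comment> \<open>The term n is the witness for I, a member of N that bounds the quantified
    number; it is not that number.\<close>
  from has_type_bvars[of T ?\<nu>s "\<sigma> # \<Delta>"] obtain bs n cs
    where bvars: "bvars ?k = bs @ n # cs" and bs: "list_all2 (has_type T ?\<Delta>) bs \<beta>s"
      and n: "has_type T ?\<Delta> n NatT" and cs: "list_all2 (has_type T ?\<Delta>) cs \<gamma>s"
    by (auto simp: list_all2_append2 list_all2_Cons2)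
  have len': "length bs = length \<beta>s" "length cs = length \<gamma>s"
    using bs cs by (auto dest: list_all2_lengthD)
  let ?H = "ball_hyps ?\<nu>s (map (lift 1) (Xs @ N # Ys)) @ map (sub (\<lambda>n. Var (n + ?k))) (Y # H)"
  let ?l = "lift (Suc ?k)"
  have hyps: "ball_hyps ?\<nu>s (map (lift 1) (Xs @ N # Ys)) =
      mem_fms \<beta>s bs (map ?l Xs) @ TMem NatT n (?l N) # mem_fms \<gamma>s cs (map ?l Ys)"
    using len len' by (simp add: ball_hyps_eq bvars[simplified] comp_def)
  let ?e = "\<lambda>n. lift ?k (up e n)" and ?em = "\<lambda>n. lift ?k (up (?m ## e) n)"
  have Y: "sub (\<lambda>n. Var (n + ?k)) Y = uball J ?em premise_matrix [] (map ?l Xs @ map ?l Ys)"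
    using sub_uball[OF wf_premise_matrix, of "[]"] len
    by (simp add: Y_def tsub_shift_Suc comp_def)
  \<comment> \<open>The two environments differ only by the entry max N for k, at index 1, which
    \<open>skip 1\<close> leaves out; \<open>env_C\<close> is the same one binder deeper.\<close>
  have env_B: "(\<lambda>n. tsub ?em (skip 1 n)) = ?e"
    by (auto simp: fun_eq_iff skip_def up_def split: nat.split)
  have B: "prv T ?\<Delta> ?H (uint J ?e (relat B) [] bs)"
  proof -
    have "sub (\<lambda>n. Var (n + ?k)) Y \<in> set ?H" by simp
    then have "prv T ?\<Delta> ?H (uball J ?em premise_matrix [] (map ?l Xs @ map ?l Ys))"
      unfolding Y by (rule prv.hyp)
    moreover have "set (mem_fms \<beta>s bs (map ?l Xs)) \<subseteq> set ?H"
      "set (mem_fms \<gamma>s cs (map ?l Ys)) \<subseteq> set ?H"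
      unfolding hyps by auto
    ultimately have "prv T ?\<Delta> ?H (uint J (\<lambda>n. tsub ?em (skip 1 n)) (relat B) [] bs)"
      by (intro premise_matrixE(1)[OF _ bs cs]) (simp_all only: len length_map)
    then show ?thesis unfolding env_B .
  qed
  \<comment> \<open>Primed objects live under one more binder, whose \<open>Var 0\<close> is the
    quantified number.\<close>
  let ?n = "lift 1 n" and ?l' = "lift (Suc (Suc ?k))"
  let ?e' = "up ?e" and ?em' = "\<lambda>n. lift 1 (?em n)"
  let ?le = "tle (Var 0) ?n"
  let ?H' = "?le # map (sub (skip 0)) ?H"
  have n': "has_type T (NatT # ?\<Delta>) ?n NatT" using n by auto
  have bs': "list_all2 (has_type T (NatT # ?\<Delta>)) (map (lift 1) bs) \<beta>s"
    and cs': "list_all2 (has_type T (NatT # ?\<Delta>)) (map (lift 1) cs) \<gamma>s"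
    using bs cs by (auto intro: has_type_lift1_map)
  have Y': "sub (skip 0) (sub (\<lambda>n. Var (n + ?k)) Y) =
      uball J ?em' premise_matrix [] (map ?l' Xs @ map ?l' Ys)"
    unfolding Y using sub_uball[OF wf_premise_matrix, of "[]"] len by (simp add: comp_def)
  have hyps': "map (sub (skip 0)) (ball_hyps ?\<nu>s (map (lift 1) (Xs @ N # Ys))) =
      mem_fms \<beta>s (map (lift 1) bs) (map ?l' Xs) @ TMem NatT ?n (?l' N) #
      mem_fms \<gamma>s (map (lift 1) cs) (map ?l' Ys)"
    unfolding hyps by (simp add: sub_mem_fms comp_def)
  have split: "x \<in> Z \<and> set As \<subseteq> Z \<and> set Bs \<subseteq> Z" if "Hs = As @ x # Bs" "set Hs \<subseteq> Z"
    for Hs As Bs :: "('g, 'c, 'q) tfm list" and x Z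
    using that by simp
  have "set (map (sub (skip 0)) (ball_hyps ?\<nu>s (map (lift 1) (Xs @ N # Ys)))) \<subseteq> set ?H'"
    by (simp only: list.set map_append set_append) blast
  note hyps_H' = split[OF hyps' this]
  have N': "has_type T (NatT # ?\<Delta>) (?l' N) (Fin NatT)"
    using has_type_lift[OF N, of "NatT # ?\<nu>s @ [\<sigma>]"] by simp
  have "prv T (NatT # ?\<Delta>) ?H' (TMem NatT ?n (?l' N))"
    using hyps_H'[THEN conjunct1] by (rule prv.hyp)
  \<comment> \<open>Nothing is known of n except that it lies in N, so k must dominate all of N;
    hence the maximum.\<close>
  then have le_max: "prv T (NatT # ?\<Delta>) ?H' (tle ?n (Cst CMax \<cdot> ?l' N))"
    using n' N' by (rule prv_le_max)
  have "prv T (NatT # ?\<Delta>) ?H' ?le" by (rule prv.hyp) simp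
  then have "prv T (NatT # ?\<Delta>) ?H' (tle (Var 0) (Cst CMax \<cdot> ?l' N))"
    by (rule prv_le_trans[OF _ le_max _ n']) (use N' in auto)
  then have le: "prv T (NatT # ?\<Delta>) ?H' (tle (Var 0) (?em' 1))" by simp
  have env_C: "(\<lambda>n. tsub (Var 0 ## ?em') (skip 2 n)) = ?e'"
    by (auto simp: fun_eq_iff skip_def up_def scons_def split: nat.split)
  have "prv T (NatT # ?\<Delta>) ?H' (uint J ?e' (relat C) [] (map (lift 1) cs))"
  proof -
    have "sub (skip 0) (sub (\<lambda>n. Var (n + ?k)) Y) \<in> set ?H'" by simp
    then have "prv T (NatT # ?\<Delta>) ?H' (uball J ?em' premise_matrix [] (map ?l' Xs @ map ?l' Ys))"
      unfolding Y' by (rule prv.hyp)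
    then have "prv T (NatT # ?\<Delta>) ?H'
        (uint J (\<lambda>n. tsub (Var 0 ## ?em') (skip 2 n)) (relat C) [] (map (lift 1) cs))"
      by (rule premise_matrixE(2)[where e="?em'" and t="Var 0", OF _ bs' cs' _ _
          hyps_H'[THEN conjunct2, THEN conjunct1]
          hyps_H'[THEN conjunct2, THEN conjunct2] _ le]) (simp_all add: len)
    then show ?thesis unfolding env_C .
  qed
  then have "prv T (NatT # ?\<Delta>) (map (sub (skip 0)) ?H)
      (TImp ?le (uint J ?e' (relat C) [] (map (lift 1) cs)))"
    using n' by (intro prv.impI wf_tle) auto
  moreover have "uint J ?e (IAll NatT (IImp (IInp NatT (Var 0)) (relat C))) [] (n # cs) =
      TAll NatT (TImp ?le (uint J ?e' (relat C) [] (map (lift 1) cs)))"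
    using uint_IImp_no_positive[OF pos_C, of "[?n]" "IInp NatT (Var 0)" ?e' "[]" "map (lift 1) cs"]
    by simp
  ultimately have "prv T ?\<Delta> ?H (uint J ?e (IAll NatT (IImp (IInp NatT (Var 0)) (relat C))) [] (n # cs))"
    using types_S_T[OF NatT_S] by (simp add: prv.allI)
  with B have "prv T ?\<Delta> ?H (uint J ?e conclusion_matrix [] (bs @ n # cs))"
    using len' by (simp add: uint_IAnd_no_positive prv.andI)
  moreover have "list_all2 (has_type T (\<sigma> # \<Delta>)) (map (lift 1) (Xs @ N # Ys)) (map Fin ?\<nu>s)"
    using Xs N Ys by (auto intro!: has_type_lift1_map list_all2_appendI)
  ultimately show ?thesis
    using prv_uballI[OF wf_conclusion_matrix, of "\<sigma> # \<Delta>" "map (lift 1) (Xs @ N # Ys)" ?k "Y # H" "up e" "[]"]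
    by (simp add: bvars[simplified])
qed

text \<open>The listed tuple is max N, b, c in the order of the negative witnesses of the premise:
  \<open>ns\<close> with N taken out and its maximum put in front. Membership suffices, because the
  antecedent holds at all elements of the sets given by \<open>ts\<close>.\<close>

lemma realization:
  assumes e: "env_typed T \<Delta> e \<Gamma>" and ns: "list_all2 (has_type T \<Delta>) ns (wneg J conclusion)"
    and ts: "list_all2 (has_type T \<Delta>) ts (wpos J (IImp premise conclusion))"
    and mem: "\<And>i. i < length (wneg J premise) \<Longrightarrow> prv T \<Delta> [] (TMem (wneg J premise ! i)
      ((Cst CMax \<cdot> (ns ! length \<beta>s) # take (length \<beta>s) ns @ drop (Suc (length \<beta>s)) ns) ! i)
      (apps (ts ! i) ns))"
  shows "prv T \<Delta> [] (uint J e (IImp premise conclusion) ts ns)"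
proof -
  from ns obtain Xs N Ys where ns_eq: "ns = Xs @ N # Ys"
    and Xs: "list_all2 (has_type T \<Delta>) Xs (map Fin \<beta>s)" and N: "has_type T \<Delta> N (Fin NatT)"
    and Ys: "list_all2 (has_type T \<Delta>) Ys (map Fin \<gamma>s)"
    by (auto simp: list_all2_append2 list_all2_Cons2)
  have len: "length Xs = length \<beta>s" "length Ys = length \<gamma>s"
    using Xs Ys by (auto dest: list_all2_lengthD)
  let ?m = "Cst CMax \<cdot> N"
  have m: "has_type T \<Delta> ?m NatT" using N by auto
  let ?X = "uball J e premise [] (map (\<lambda>t. apps t ns) ts)"
  let ?Y = "uball J (up (?m ## e)) premise_matrix [] (map (lift 1) (Xs @ Ys))"
  let ?Q = "uball J (up e) conclusion_matrix [] (map (lift 1) ns)"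
  have ts': "list_all2 (has_type T \<Delta>) (map (\<lambda>t. apps t ns) ts) (map Fin (wneg J premise))"
    using has_type_map_apps[OF ns, of ts "map Fin (wneg J premise)"] ts by (simp add: comp_def)
  have "list_all2 (has_type T \<Delta>) (?m # Xs @ Ys) (wneg J premise)"
    using m Xs Ys by (auto intro: list_all2_appendI)
  moreover have "prv T \<Delta> [?X] (TMem (wneg J premise ! i) ((?m # Xs @ Ys) ! i) (map (\<lambda>t. apps t ns) ts ! i))"
    if i: "i < length (wneg J premise)" for i
  proof -
    have "length ts = length (wneg J premise)" using list_all2_lengthD[OF ts'] by simp
    then show ?thesis using prv_weaken[OF mem[OF i], of "[?X]"] i len by (simp add: ns_eq nth_append)
  qed
  ultimately have "prv T \<Delta> [?X] (uint J e premise [] (?m # Xs @ Ys))"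
    by (intro prv_uballE[OF _ wf_premise]) (auto intro: prv.hyp)
  \<comment> \<open>The term max N serves both as the value of k and as the witness bounding it, so
    I(k) becomes max N \<le> max N.\<close>
  from prv_uint_allE[OF this m, of "NatT # \<Gamma>"]
  have "prv T \<Delta> [?X] (uint J (?m ## e) (IImp (IInp NatT (Var 0)) (IEx \<sigma> premise_matrix)) [] ([?m] @ Xs @ Ys))"
    using wf_premise len by simp
  then have "prv T \<Delta> [?X] (TImp (tle ?m ?m) (uint J (?m ## e) (IEx \<sigma> premise_matrix) [] (Xs @ Ys)))"
    by (subst (asm) uint_IImp_no_positive) simp_all
  from prv.impE[OF this prv_le_refl[OF m]]
  have ex: "prv T \<Delta> [?X] (TEx \<sigma> ?Y)" by (simp add: uint_IEx)
  have lift_conclusion: "sub (skip 0) (uint J e conclusion [] ns) =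
      TEx \<sigma> (uball J (up (\<lambda>n. lift 1 (e n))) conclusion_matrix [] (map (lift 1) (map (lift 1) ns)))"
    using sub_uint[OF wf_conclusion, of "[]" ns "skip 0" e] list_all2_lengthD[OF ns]
    by (simp add: uint_IEx comp_def)
  have shift: "tsub (inst [Var 0]) (lift (Suc (Suc 0)) t) = lift 1 t" for t :: "('g, 'c) tm"
    using tsub_inst_lift[of "[Var 0]" 1 "lift 1 t"] by simp
  \<comment> \<open>Instantiation at \<open>Var 0\<close> makes the x of the conclusion the
    eigenvariable x obtained from the premise.\<close>
  have "sub (inst [Var 0]) (uball J (up (\<lambda>n. lift 1 (e n))) conclusion_matrix [] (map (lift 1) (map (lift 1) ns))) = ?Q"
    using sub_uball[OF wf_conclusion_matrix, of "[]"] list_all2_lengthD[OF ns]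
    by (simp add: comp_def up_eq tsub_scons shift inst_def[of _ 0])
  moreover have "prv T (\<sigma> # \<Delta>) (?Y # map (sub (skip 0)) [?X]) ?Q"
    unfolding ns_eq by (rule conclusion_matrixI[OF e Xs N Ys])
  moreover have "wf_tfm T (\<sigma> # \<Delta>) (sub (skip 0) (uint J e conclusion [] ns))"
  proof (rule wf_tfm_sub)
    show "wf_tfm T \<Delta> (uint J e conclusion [] ns)" using wf_uint[OF wf_conclusion e _ ns] by simp
    show "env_typed T (\<sigma> # \<Delta>) (skip 0) \<Delta>" by (simp add: env_typed_def skip_def)
  qed
  ultimately have "prv T (\<sigma> # \<Delta>) (?Y # map (sub (skip 0)) [?X]) (sub (skip 0) (uint J e conclusion [] ns))"
    unfolding lift_conclusion by (intro prv.exI[of _ _ _ _ "Var 0"]) simp_all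
  then have "prv T \<Delta> [?X] (uint J e conclusion [] ns)"
    using wf_uint[OF wf_conclusion e _ ns] by (intro prv.exE[OF ex]) simp_all
  moreover have "wf_tfm T \<Delta> ?X" using ts' by (intro wf_uball[OF wf_premise e]) simp_all
  ultimately have "prv T \<Delta> [] (TImp ?X (uint J e conclusion [] ns))"
    by (intro prv.impI)
  then show ?thesis
    using uint_IImp_no_positive[of J conclusion "[]" premise e ts ns] by simp
qed

text \<open>Every component is a projection followed by a singleton, of the maximum for the bound of
  k and of the argument itself otherwise; the leading arguments of types \<open>\<pi>s\<close> are
  discarded.\<close>

lemma projection_realizer:
  assumes "set \<pi>s \<subseteq> wtypes T" and i: "i < length (wneg J premise)"
  shows "\<exists>t. has_type T [] t (arrows (\<pi>s @ wneg J conclusion) (Fin (wneg J premise ! i))) \<and>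
    (\<forall>\<Delta> ps ns. list_all2 (has_type T \<Delta>) ps \<pi>s \<longrightarrow> list_all2 (has_type T \<Delta>) ns (wneg J conclusion) \<longrightarrow>
      prv T \<Delta> [] (TMem (wneg J premise ! i)
        ((Cst CMax \<cdot> (ns ! length \<beta>s) # take (length \<beta>s) ns @ drop (Suc (length \<beta>s)) ns) ! i)
        (apps (apps t ps) ns)))"
proof -
  let ?\<sigma>s = "\<pi>s @ wneg J conclusion"
  have w: "set \<beta>s \<subseteq> wtypes T" "set \<gamma>s \<subseteq> wtypes T"
    using wneg_w[OF wf_relat_B] wneg_w[OF wf_relat_C] by auto
  then have \<sigma>s: "set ?\<sigma>s \<subseteq> wtypes T" using assms(1) by auto
  show ?thesis
  proof (cases i)
    case 0
    \<comment> \<open>The position of N, behind the guard's arguments and b.\<close>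
    let ?j = "length \<pi>s + length \<beta>s"
    have j: "?\<sigma>s ! ?j = Fin NatT" "?j < length ?\<sigma>s" by (simp_all add: nth_append)
    obtain g where g: "has_type T [] g (Fun (Fin NatT) (Fin NatT))"
      and g_mem: "\<And>\<Gamma> H X. has_type T \<Gamma> X (Fin NatT) \<Longrightarrow> prv T \<Gamma> H (TMem NatT (Cst CMax \<cdot> X) (g \<cdot> X))"
      using singleton_max_term by blast
    have "has_type T [] g (Fun (?\<sigma>s ! ?j) (Fin NatT))"
      "\<And>\<Gamma> X. has_type T \<Gamma> X (?\<sigma>s ! ?j) \<Longrightarrow> has_type T \<Gamma> (Cst CMax \<cdot> X) NatT"
      "\<And>\<Gamma> H X. has_type T \<Gamma> X (?\<sigma>s ! ?j) \<Longrightarrow> prv T \<Gamma> H (TMem NatT (Cst CMax \<cdot> X) (g \<cdot> X))"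
      unfolding j(1) using g g_mem by auto
    from member_projection_term[OF this(1) j(2) \<sigma>s NatT_w this(2,3)]
    obtain f where f: "has_type T [] f (arrows ?\<sigma>s (Fin NatT))"
      and mem: "\<And>\<Delta> H ts. list_all2 (has_type T \<Delta>) ts ?\<sigma>s \<Longrightarrow>
        prv T \<Delta> H (TMem NatT (Cst CMax \<cdot> (ts ! ?j)) (apps f ts))"
      by blast
    have "prv T \<Delta> [] (TMem NatT (Cst CMax \<cdot> (ns ! length \<beta>s)) (apps (apps f ps) ns))"
      if "list_all2 (has_type T \<Delta>) ps \<pi>s" "list_all2 (has_type T \<Delta>) ns (wneg J conclusion)" for \<Delta> ps ns
      using mem[OF list_all2_appendI[OF that], of "[]"] list_all2_lengthD[OF that(1)]
      by (simp add: nth_append apps_append)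
    with f 0 show ?thesis by auto
  next
    case (Suc l)
    \<comment> \<open>Entry l of b, c sits in \<open>ns\<close> at the same place if it belongs to
      b, and one place further if it belongs to c, because N stands between them.\<close>
    let ?l = "if l < length \<beta>s then l else Suc l"
    let ?j = "length \<pi>s + ?l" and ?\<tau> = "wneg J premise ! i"
    have l: "l < length \<beta>s + length \<gamma>s" using i Suc by simp
    have j: "?\<sigma>s ! ?j = ?\<tau>" "?j < length ?\<sigma>s"
      using l Suc by (auto simp: nth_append nth_Cons' Suc_diff_le)
    from subsetD[OF \<sigma>s nth_mem[OF j(2)]] have \<tau>: "?\<tau> \<in> wtypes T" unfolding j(1) .
    have "has_type T [] (Cst (CSing ?\<tau>)) (Fun (?\<sigma>s ! ?j) (Fin ?\<tau>))"
      "\<And>\<Gamma> t. has_type T \<Gamma> t (?\<sigma>s ! ?j) \<Longrightarrow> has_type T \<Gamma> t ?\<tau>"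
      "\<And>\<Gamma> H t. has_type T \<Gamma> t (?\<sigma>s ! ?j) \<Longrightarrow> prv T \<Gamma> H (TMem ?\<tau> t (Cst (CSing ?\<tau>) \<cdot> t))"
      unfolding j(1) using \<tau> by (simp_all only: has_type.simps const_type.simps CSing_T prv_mem_sing)
    from member_projection_term[where h="\<lambda>t. t", OF this(1) j(2) \<sigma>s \<tau> this(2,3)]
    obtain f where f: "has_type T [] f (arrows ?\<sigma>s (Fin ?\<tau>))"
      and mem: "\<And>\<Delta> H ts. list_all2 (has_type T \<Delta>) ts ?\<sigma>s \<Longrightarrow>
        prv T \<Delta> H (TMem ?\<tau> (ts ! ?j) (apps f ts))"
      by blast
    have "prv T \<Delta> [] (TMem ?\<tau>
        ((Cst CMax \<cdot> (ns ! length \<beta>s) # take (length \<beta>s) ns @ drop (Suc (length \<beta>s)) ns) ! i)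
        (apps (apps f ps) ns))"
      if "list_all2 (has_type T \<Delta>) ps \<pi>s" and ns: "list_all2 (has_type T \<Delta>) ns (wneg J conclusion)" for \<Delta> ps ns
    proof -
      have "(Cst CMax \<cdot> (ns ! length \<beta>s) # take (length \<beta>s) ns @ drop (Suc (length \<beta>s)) ns) ! i = ns ! ?l"
        using l Suc list_all2_lengthD[OF ns] by (auto simp: nth_append)
      then show ?thesis
        using mem[OF list_all2_appendI[OF that], of "[]"] list_all2_lengthD[OF that(1)]
        by (simp add: nth_append apps_append)
    qed
    with f show ?thesis by blast
  qed
qed

end

theorem theorem9p14:
  fixes S :: "('g, 'c, 'r) source"
    and T :: "('g, 'c, 'q) target"
    and J :: "('g, 'c, 'r, 'q) base"
    and \<sigma> :: "'g ty" and \<tau>s \<rho>s :: "'g ty list"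
    and B C :: "('g, 'c, 'r) sfm"
  assumes "extends_HA S"
    and "target_theory S T"
    and "base_interpretation S T J"
    and "bounding_at_Nat J"
    and "\<sigma> \<in> types S" and "set \<tau>s \<subseteq> types S" and "set \<rho>s \<subseteq> types S"
    \<comment> \<open>\<open>B(x, y)\<close> with \<open>x, y\<close> of types \<open>\<sigma>, \<tau>s\<close>\<close>
    and "wf_sfm S (\<sigma> # \<tau>s) B"
    and "semi_uniform T J \<sigma> \<tau>s B"
    \<comment> \<open>\<open>C(x, n)\<close> in the context \<open>n, x, y, z\<close>, with parameters \<open>z\<close> of types \<open>\<rho>s\<close>\<close>
    and "wf_sfm S (NatT # \<sigma> # \<tau>s @ \<rho>s) C"
    and "no_positive_witnesses J C"
  shows "I_interpretable T J (\<tau>s @ \<rho>s)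
    (SImp
      \<comment> \<open>context of \<open>B\<close>: \<open>x, k, y, z\<close>; of \<open>n \<le> k\<close> and \<open>C\<close>: \<open>n, x, k, y, z\<close>\<close>
      (SAll NatT (SREx \<sigma> (ssub (skip 1) B)
        (SRAll NatT (sle (Var 0) (Var 2)) (ssub (skip 2) C))))
      (SREx \<sigma> B (SAll NatT C)))"
proof -
  interpret contra_collection S T J \<sigma> \<tau>s \<rho>s B C
    using assms by unfold_locales (auto simp: semi_uniform_def no_positive_witnesses_def)
  have "U_interpretable T J [] (input_closure \<Gamma> (IImp premise conclusion))"
  \<comment> \<open>The specification \<open>P i\<close> is that the set produced by the i-th
    realizer contains the i-th entry of max N, b, c; it is fixed by the goals shown below.\<close>
  proof (rule U_interpretable_input_closureI)
    show "set \<Gamma> \<subseteq> types S" using \<tau>s_S \<rho>s_S by simp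
    show "wf_ifm S \<Gamma> (IImp premise conclusion)" using wf_premise wf_conclusion by simp
    \<comment> \<open>The conclusion has no positive witnesses, which leaves only the functions
      giving sets of negative witnesses of the premise; these take no witnesses of the premise,
      since it has no positive ones either.\<close>
    show "wpos J (IImp premise conclusion) =
        map (arrows (wneg J (IImp premise conclusion))) (map Fin (wneg J premise))"
      by (simp add: comp_def)
  next
    fix \<pi>s i assume "set \<pi>s \<subseteq> wtypes T" and i: "i < length (map Fin (wneg J premise))"
    with projection_realizer[of \<pi>s i]
    show "\<exists>t. has_type T [] t (arrows (\<pi>s @ wneg J (IImp premise conclusion)) (map Fin (wneg J premise) ! i)) \<and>
      (\<forall>\<Delta> ps ns. list_all2 (has_type T \<Delta>) ps \<pi>s \<longrightarrow>
        list_all2 (has_type T \<Delta>) ns (wneg J (IImp premise conclusion)) \<longrightarrow>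
        prv T \<Delta> [] (TMem (wneg J premise ! i)
          ((Cst CMax \<cdot> (ns ! length \<beta>s) # take (length \<beta>s) ns @ drop (Suc (length \<beta>s)) ns) ! i)
          (apps (apps t ps) ns)))"
      by (simp only: length_map nth_map wneg.simps(5) wpos_premise append_Nil)
  next
    fix \<Delta> e ts ns
    assume "env_typed T \<Delta> e \<Gamma>" "list_all2 (has_type T \<Delta>) ns (wneg J (IImp premise conclusion))"
      "list_all2 (has_type T \<Delta>) ts (wpos J (IImp premise conclusion))"
      and "\<And>i. i < length (map Fin (wneg J premise)) \<Longrightarrow>
        prv T \<Delta> [] (TMem (wneg J premise ! i)
          ((Cst CMax \<cdot> (ns ! length \<beta>s) # take (length \<beta>s) ns @ drop (Suc (length \<beta>s)) ns) ! i)
          (apps (ts ! i) ns))"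
    then show "prv T \<Delta> [] (uint J e (IImp premise conclusion) ts ns)"
      by (intro realization) (simp_all only: length_map wneg.simps(5) wpos_premise append_Nil)
  qed
  then show ?thesis by (simp add: I_interpretable_def)
qed

end
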